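(* Let $A\subset\mathbb{R}^d$ be bounded with $V_A(0)=0$ and let $h:(0,\infty)\to(0,\infty)$ be a differentiable function with $\lim_{r\to 0} h(r)=0$. Assume that $h'$ is nonzero on some right neighbourhood of $0$. Then $$\underline{\mathcal{S}}(h';A)\le \underline{\mathcal{M}}(h;A)\le \overline{\mathcal{M}}(h;A)\le \overline{\mathcal{S}}(h';A).$$
   Context: Let $d\ge 1$ be an integer and $A\subset\mathbb{R}^d$ bounded. For $r\ge0$ let $A_r:=\{z\in\mathbb{R}^d: d_A(z)\le r\}$ be the $r$-parallel set, where $d_A$ is the Euclidean distance function of $A$ (so $A_0$ is the closure of $A$). Let $\mathcal{H}^t$ denote $t$-dimensional Hausdorff measure, $V_A(r):=\mathcal{H}^d(A_r)$ for $r\ge0$, and $S_A(r):=\mathcal{H}^{d-1}(\partial A_r)$ for $r>0$. The lower and upper generalized Minkowski contents of $A$ with respect to $h$ are $$\underline{\mathcal{M}}(h;A):=\liminf_{r\to0}\frac{V_A(r)}{h(r)},\qquad \overline{\mathcal{M}}(h;A):=\limsup_{r\to0}\frac{V_A(r)}{h(r)},$$ and the lower and upper generalized S-contents of $A$ with respect to $h'$ are $$\underline{\mathcal{S}}(h';A):=\liminf_{r\to0}\frac{S_A(r)}{h'(r)},\qquad \overline{\mathcal{S}}(h';A):=\limsup_{r\to0}\frac{S_A(r)}{h'(r)} .$$ All quantities take values in $[0,\infty]$. *)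

theory Defs
  imports "HOL-Analysis.Analysis"
begin

text \<open>
  Hausdorff measure with the normalisation for which it coincides with Lebesgue measure in the
  top dimension: \<open>unit_ball_vol t\<close> is \<open>pi powr (t/2) / Gamma (t/2 + 1)\<close>. The cases \<open>E = {}\<close> and
  \<open>t = 0\<close> are separated because \<open>0 powr 0 = 0\<close>, whereas zero-dimensional Hausdorff measure is
  counting measure.
\<close>

definition hausdorff_gauge :: "real \<Rightarrow> 'a::metric_space set \<Rightarrow> ennreal" where
  "hausdorff_gauge t E =
     (if E = {} then 0
      else if t = 0 then 1
      else ennreal (unit_ball_vol t * (diameter E / 2) powr t))"

text \<open>Boundedness is required explicitly since \<^const>\<open>diameter\<close> is unspecified on unbounded sets.\<close>

definition hausdorff_premeasure :: "real \<Rightarrow> real \<Rightarrow> 'a::metric_space set \<Rightarrow> ennreal" where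
  "hausdorff_premeasure t \<delta> S =
     Inf {(\<Sum>i. hausdorff_gauge t (E i)) | E :: nat \<Rightarrow> 'a set.
            S \<subseteq> (\<Union>i. E i) \<and> (\<forall>i. bounded (E i) \<and> diameter (E i) \<le> \<delta>)}"

definition hausdorff_measure :: "real \<Rightarrow> 'a::metric_space set \<Rightarrow> ennreal" where
  "hausdorff_measure t S = (SUP \<delta>\<in>{0<..}. hausdorff_premeasure t \<delta> S)"

text \<open>
  The distance to the empty set is infinite, so all parallel sets of \<open>{}\<close> are empty; this needs the
  guard because \<open>infdist z {} = 0\<close>.
\<close>

definition parallel_set :: "'a::metric_space set \<Rightarrow> real \<Rightarrow> 'a set" where
  "parallel_set A r = {z. A \<noteq> {} \<and> infdist z A \<le> r}"

lemma parallel_set_0: "parallel_set A 0 = closure A"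
proof (cases "A = {}")
  case False
  have "infdist z A \<le> 0 \<longleftrightarrow> z \<in> closure A" for z
    using in_closure_iff_infdist_zero[OF False, of z] infdist_nonneg[of z A] by linarith
  with False show ?thesis by (auto simp: parallel_set_def)
qed (simp add: parallel_set_def)

definition parallel_volume :: "'a::euclidean_space set \<Rightarrow> real \<Rightarrow> ennreal" where
  "parallel_volume A r = hausdorff_measure (real DIM('a)) (parallel_set A r)"

definition parallel_surface :: "'a::euclidean_space set \<Rightarrow> real \<Rightarrow> ennreal" where
  "parallel_surface A r = hausdorff_measure (real (DIM('a) - 1)) (frontier (parallel_set A r))"

text \<open>
  The contents are formed in \<^typ>\<open>ereal\<close> rather than \<^typ>\<open>ennreal\<close> so that the sign of the
  denominator, which may be a derivative, is not truncated.
\<close>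

definition lower_minkowski_content :: "(real \<Rightarrow> real) \<Rightarrow> 'a::euclidean_space set \<Rightarrow> ereal" where
  "lower_minkowski_content h A =
     Liminf (at_right 0) (\<lambda>r. enn2ereal (parallel_volume A r) / ereal (h r))"

definition upper_minkowski_content :: "(real \<Rightarrow> real) \<Rightarrow> 'a::euclidean_space set \<Rightarrow> ereal" where
  "upper_minkowski_content h A =
     Limsup (at_right 0) (\<lambda>r. enn2ereal (parallel_volume A r) / ereal (h r))"

definition lower_S_content :: "(real \<Rightarrow> real) \<Rightarrow> 'a::euclidean_space set \<Rightarrow> ereal" where
  "lower_S_content g A =
     Liminf (at_right 0) (\<lambda>r. enn2ereal (parallel_surface A r) / ereal (g r))"

definition upper_S_content :: "(real \<Rightarrow> real) \<Rightarrow> 'a::euclidean_space set \<Rightarrow> ereal" where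
  "upper_S_content g A =
     Limsup (at_right 0) (\<lambda>r. enn2ereal (parallel_surface A r) / ereal (g r))"

end

(*
  Write d for the distance to A, V(r) for the volume of the r-parallel set and S(r) for the surface
  area of its frontier. For every r > 0 one has D^+ V(r) <= S(r) <= D_- V(r) (upper right and lower
  left Dini derivatives), without exceptional radii. Since h' > 0 near 0, an inequality c h' < S or
  S < c h' near 0 then makes V - c h monotone, and letting the lower end point tend to 0, where V
  and h vanish, gives c h <= V or V <= c h.

  Both bounds come from following the segments from a point to a nearest point of A. In the interior
  of such a segment d has a quadratic two-sided tangent, because the level set is touched by balls
  from both sides; and moving outwards from level s to level r along the segments expands distances
  by a factor at most r/s. No coarea formula or rectifiability theory is needed, but the Hausdorff
  measures have sharp constants, so the isodiametric inequality (by Steiner symmetrization) and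
  Vitali's covering theorem enter, in dimension d and, by slicing, in dimension d - 1.
*)
theory Submission
  imports Defs
begin

section \<open>The isodiametric inequality\<close>

text \<open>A segment to a nearest point gives tangent balls on both sides only in its interior: the
  constant \<open>K\<close> of the quadratic bound is half the larger of the two curvatures and
  blows up at either end. This shapes both estimates. They are proved for layers at a positive
  distance from the level in question, where one \<open>K\<close> serves all points. The errors, of
  order \<open>K\<close> times the mesh of a cover or the thickness of a layer, vanish under
  refinement while \<open>K\<close> stays fixed, and only then does the layer approach the level.
  What survives are the expansion factors \<open>(r / t) ^ (d - 1)\<close> and
  \<open>(R / r) ^ (d - 1)\<close>, which tend to 1.

  No constant may be lost between dimensions d - 1 and d. In the bound on the surface area the match
  is Cavalieri's principle: the slices of a ball integrate to its volume. In the bound on the volume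
  it is the cylinder: height times the isodiametric bound of the cross section.\<close>

lemma emeasure_pair_diff_le:
  fixes A B :: "real set" and l :: real
  assumes "A \<noteq> {}" "B \<noteq> {}" and AB: "\<And>a b. a \<in> A \<Longrightarrow> b \<in> B \<Longrightarrow> \<bar>a - b\<bar> \<le> l"
  shows "emeasure lborel A + emeasure lborel B \<le> ennreal (2 * l)"
proof -
  obtain a b where ab: "a \<in> A" "b \<in> B" using assms by auto
  have bA: "bdd_above A" "bdd_below A"
    using AB ab by (auto intro!: bdd_aboveI[of _ "b + l"] bdd_belowI[of _ "b - l"]) (smt (verit))+
  have bB: "bdd_above B" "bdd_below B"
    using AB ab by (auto intro!: bdd_aboveI[of _ "a + l"] bdd_belowI[of _ "a - l"]) (smt (verit))+
  \<comment> \<open>\<open>C\<close> may be non-measurable; monotonicity asks only that the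
    enclosing interval be measurable.\<close>
  have *: "emeasure lborel C \<le> ennreal (Sup C - Inf C)" if "bdd_above C" "bdd_below C" "C \<noteq> {}" for C :: "real set"
  proof -
    have "C \<subseteq> {Inf C..Sup C}" using that by (auto intro: cInf_lower cSup_upper)
    then have "emeasure lborel C \<le> emeasure lborel {Inf C..Sup C}" by (intro emeasure_mono) auto
    also have "\<dots> = ennreal (Sup C - Inf C)" using that by (simp add: cInf_le_cSup)
    finally show ?thesis .
  qed
  \<comment> \<open>The cross bounds on \<open>Sup A - Inf B\<close> and
    \<open>Sup B - Inf A\<close> add up to the bound on the sum of the lengths of the two
    hulls.\<close>
  have "Sup A \<le> Inf B + l"
  proof (rule cSup_least)
    fix a assume "a \<in> A"
    have "a - l \<le> Inf B" using AB[OF \<open>a \<in> A\<close>] by (intro cInf_greatest) (auto simp: assms, smt (verit))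
    then show "a \<le> Inf B + l" by simp
  qed (fact assms)
  moreover have "Sup B \<le> Inf A + l"
  proof (rule cSup_least)
    fix b assume "b \<in> B"
    have "b - l \<le> Inf A" using AB[OF _ \<open>b \<in> B\<close>] by (intro cInf_greatest) (auto simp: assms, smt (verit))
    then show "b \<le> Inf A + l" by simp
  qed (fact assms)
  moreover have "Inf A \<le> Sup A" "Inf B \<le> Sup B" using bA bB assms by (auto intro: cInf_le_cSup)
  ultimately show ?thesis
    using *[OF bA assms(1)] *[OF bB assms(2)]
    by (smt (verit) add_mono ennreal_leI ennreal_plus order_trans)
qed

section \<open>Steiner symmetrization along a coordinate\<close>

abbreviation Lborel_on :: "'i set \<Rightarrow> ('i \<Rightarrow> real) measure" where
  "Lborel_on I \<equiv> Pi\<^sub>M I (\<lambda>_. lborel)"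

definition line_length :: "'i \<Rightarrow> ('i \<Rightarrow> real) set \<Rightarrow> ('i \<Rightarrow> real) \<Rightarrow> ennreal" where
  "line_length i E x = emeasure lborel {t. x(i := t) \<in> E}"

text \<open>
  Points whose line misses \<open>E\<close> must be discarded; the strict inequality does this without a
  projection, so that measurability is plain Tonelli.
\<close>

definition steiner :: "'i set \<Rightarrow> 'i \<Rightarrow> ('i \<Rightarrow> real) set \<Rightarrow> ('i \<Rightarrow> real) set" where
  "steiner I i E = {x \<in> space (Lborel_on I). ennreal (2 * \<bar>x i\<bar>) < line_length i E x}"

lemma line_length_measurable [measurable]:
  assumes [measurable]: "E \<in> sets (Lborel_on I)" and i: "i \<in> I"
  shows "line_length i E \<in> borel_measurable (Lborel_on I)"
proof -
  \<comment> \<open>Since \<open>i\<close> already belongs to \<open>I\<close>, adding the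
    coordinate \<open>i\<close> overwrites it, so the update map stays within one product
    space.\<close>
  have I: "insert i I = I" using i by auto
  let ?f = "\<lambda>(x, t). x(i := t) :: _ \<Rightarrow> real"
  have f[measurable]: "?f \<in> Lborel_on I \<Otimes>\<^sub>M lborel \<rightarrow>\<^sub>M Lborel_on I"
    using measurable_add_dim[of i I "\<lambda>_. lborel"] unfolding I by simp
  let ?Q = "?f -` E \<inter> space (Lborel_on I \<Otimes>\<^sub>M lborel)"
  have "?Q \<in> sets (Lborel_on I \<Otimes>\<^sub>M lborel)" by measurable
  then have "(\<lambda>x. emeasure lborel (Pair x -` ?Q)) \<in> borel_measurable (Lborel_on I)"
    by (rule lborel.measurable_emeasure_Pair)
  moreover have "emeasure lborel (Pair x -` ?Q) = line_length i E x" if "x \<in> space (Lborel_on I)" for x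
    using that by (auto simp: line_length_def space_pair_measure intro!: arg_cong[where f="emeasure lborel"])
  then have "line_length i E \<in> borel_measurable (Lborel_on I) \<longleftrightarrow> (\<lambda>x. emeasure lborel (Pair x -` ?Q)) \<in> borel_measurable (Lborel_on I)"
    by (intro measurable_cong) (simp only: \<open>\<And>x. x \<in> space (Lborel_on I) \<Longrightarrow> emeasure lborel (Pair x -` ?Q) = line_length i E x\<close>)
  ultimately show ?thesis by blast
qed

lemma sets_steiner [measurable]:
  assumes "E \<in> sets (Lborel_on I)" "i \<in> I"
  shows "steiner I i E \<in> sets (Lborel_on I)"
proof -
  note [measurable] = assms line_length_measurable[OF assms] measurable_component_singleton[OF assms(2), of "\<lambda>_. lborel"]
  show ?thesis unfolding steiner_def by measurable
qed

lemma emeasure_eq_line_length: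
  assumes "finite J" "i \<notin> J" and E: "E \<in> sets (Lborel_on (insert i J))"
  shows "emeasure (Lborel_on (insert i J)) E = (\<integral>\<^sup>+ x. line_length i E x \<partial>Lborel_on J)"
proof -
  interpret product_sigma_finite "\<lambda>_. lborel" by standard
  have "emeasure (Lborel_on (insert i J)) E = (\<integral>\<^sup>+ x. indicator E x \<partial>Lborel_on (insert i J))"
    using E by simp
  also have "\<dots> = (\<integral>\<^sup>+ x. \<integral>\<^sup>+ t. indicator E (x(i := t)) \<partial>lborel \<partial>Lborel_on J)"
    using assms by (intro product_nn_integral_insert) auto
  also have "\<dots> = (\<integral>\<^sup>+ x. line_length i E x \<partial>Lborel_on J)"
  proof (intro nn_integral_cong)
    fix x assume x: "x \<in> space (Lborel_on J)"
    have "(\<lambda>t. x(i := t)) \<in> lborel \<rightarrow>\<^sub>M Lborel_on (insert i J)"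
      using x by (intro measurable_fun_upd[where J=J]) auto
    then have "(\<lambda>t. x(i := t)) -` E \<inter> space lborel \<in> sets lborel" using E by (rule measurable_sets)
    then have "{t. x(i := t) \<in> E} \<in> sets lborel" by (simp add: vimage_def)
    then have "line_length i E x = (\<integral>\<^sup>+ t. indicator {t. x(i := t) \<in> E} t \<partial>lborel)"
      by (simp add: line_length_def)
    then show "(\<integral>\<^sup>+ t. indicator E (x(i := t)) \<partial>lborel) = line_length i E x"
      by (simp add: indicator_def)
  qed
  finally show ?thesis .
qed

lemma line_length_upd [simp]: "line_length i E (x(i := t)) = line_length i E x"
  by (simp add: line_length_def)

text \<open>The set is the fibre of \<open>steiner I i E\<close> when \<open>m\<close> is the length
  of the original fibre; lengths 0 and infinity are preserved as well.\<close>

lemma emeasure_centred_interval: "emeasure lborel {t::real. ennreal (2 * \<bar>t\<bar>) < m} = m"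
proof (cases m)
  case (real r)
  have "{t::real. ennreal (2 * \<bar>t\<bar>) < m} = {-r/2<..<r/2}"
    using real by (auto simp: ennreal_less_iff)
  then show ?thesis using real by simp
next
  case top
  then show ?thesis by (simp add: ennreal_less_top)
qed

lemma emeasure_steiner:
  assumes "finite I" "i \<in> I" "E \<in> sets (Lborel_on I)"
  shows "emeasure (Lborel_on I) (steiner I i E) = emeasure (Lborel_on I) E"
proof -
  define J where "J = I - {i}"
  have I: "I = insert i J" and J: "i \<notin> J" "finite J" using assms by (auto simp: J_def)
  have "line_length i (steiner I i E) x = line_length i E x" if "x \<in> space (Lborel_on J)" for x
  proof -
    have "x(i := t) \<in> space (Lborel_on I)" for t using that by (auto simp: I space_PiM PiE_def extensional_def)
    then have "line_length i (steiner I i E) x = emeasure lborel {t::real. ennreal (2 * \<bar>t\<bar>) < line_length i E x}"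
      by (subst line_length_def) (simp add: steiner_def)
    then show ?thesis by (simp add: emeasure_centred_interval)
  qed
  then show ?thesis
    using emeasure_eq_line_length[OF J(2,1), of E] emeasure_eq_line_length[OF J(2,1), of "steiner I i E"]
      sets_steiner[OF assms(3,2)] assms
    by (simp add: I[symmetric] cong: nn_integral_cong)
qed

text \<open>Only the coordinate \<open>i\<close> is rearranged. Points of the two fibres differ by
  at most \<open>sqrt (D\<^sup>2 - s)\<close>, so the fibre lengths add up to at most twice that.
  Since \<open>2 * \<bar>x i\<bar>\<close> and \<open>2 * \<bar>y i\<bar>\<close> lie below these
  lengths, \<open>\<bar>x i\<bar> + \<bar>y i\<bar>\<close> obeys the same bound as the original
  differences.\<close>

lemma steiner_sq_dist_le:
  assumes I: "finite I" "i \<in> I"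
    and E: "\<And>x y. x \<in> E \<Longrightarrow> y \<in> E \<Longrightarrow> (\<Sum>j\<in>I. (x j - y j)\<^sup>2) \<le> D\<^sup>2"
    and xy: "x \<in> steiner I i E" "y \<in> steiner I i E"
  shows "(\<Sum>j\<in>I. (x j - y j)\<^sup>2) \<le> D\<^sup>2"
proof -
  define A B where "A = {t. x(i := t) \<in> E}" and "B = {t. y(i := t) \<in> E}"
  define s where "s = (\<Sum>j\<in>I - {i}. (x j - y j)\<^sup>2)"
  have m: "ennreal (2 * \<bar>x i\<bar>) < emeasure lborel A" "ennreal (2 * \<bar>y i\<bar>) < emeasure lborel B"
    using xy by (auto simp: steiner_def line_length_def A_def B_def)
  then have ne: "A \<noteq> {}" "B \<noteq> {}" by (auto intro!: notI)
  have sq: "s + (a - b)\<^sup>2 \<le> D\<^sup>2" if "a \<in> A" "b \<in> B" for a b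
  proof -
    have "x(i := a) \<in> E" "y(i := b) \<in> E" using that by (simp_all add: A_def B_def)
    from E[OF this] show ?thesis using I by (simp add: sum.remove[of I i] s_def)
  qed
  have s: "s \<le> D\<^sup>2" using ne sq by (smt (verit) ex_in_conv zero_le_power2)
  have "\<bar>a - b\<bar> \<le> sqrt (D\<^sup>2 - s)" if "a \<in> A" "b \<in> B" for a b
    using sq[OF that] by (intro real_le_rsqrt) simp
  then have AB: "emeasure lborel A + emeasure lborel B \<le> ennreal (2 * sqrt (D\<^sup>2 - s))"
    using emeasure_pair_diff_le[OF ne] by blast
  have "ennreal (2 * \<bar>x i\<bar> + 2 * \<bar>y i\<bar>) \<le> ennreal (2 * sqrt (D\<^sup>2 - s))"
    using m AB by (simp add: ennreal_plus) (meson add_mono less_imp_le order_trans)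
  then have "\<bar>x i - y i\<bar> \<le> sqrt (D\<^sup>2 - s)"
    using s by (subst (asm) ennreal_le_iff) auto
  then have "(x i - y i)\<^sup>2 \<le> D\<^sup>2 - s"
    using s by (metis abs_le_square_iff abs_of_nonneg diff_ge_0_iff_ge power2_abs real_sqrt_ge_0_iff real_sqrt_pow2)
  then show ?thesis using I by (simp add: sum.remove[of I i] s_def)
qed

lemma steiner_flip:
  assumes "x \<in> steiner I i E" "i \<in> I"
  shows "x(i := - x i) \<in> steiner I i E"
  using assms by (auto simp: steiner_def space_PiM PiE_def extensional_def)

text \<open>Reflecting the coordinate \<open>j\<close> carries a line in direction \<open>i\<close>
  to another such line and leaves its fibre of \<open>E\<close> unchanged. Hence symmetrizing in a
  new coordinate keeps the symmetries already gained.\<close>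

lemma steiner_flip_other:
  assumes E: "\<And>x. x \<in> E \<Longrightarrow> x(j := - x j) \<in> E" and x: "x \<in> steiner I i E" and ij: "i \<noteq> j" "j \<in> I"
  shows "x(j := - x j) \<in> steiner I i E"
proof -
  have "{t. x(i := t) \<in> E} = {t. x(j := - x j, i := t) \<in> E}"
  proof (intro Collect_cong iffI)
    fix t assume "x(i := t) \<in> E"
    from E[OF this] show "x(j := - x j, i := t) \<in> E" using ij by (simp add: fun_upd_twist)
  next
    fix t assume "x(j := - x j, i := t) \<in> E"
    from E[OF this] have "(x(j := - x j, i := t))(j := x j) \<in> E" using ij by simp
    also have "(x(j := - x j, i := t))(j := x j) = x(i := t)" using ij by (auto simp: fun_eq_iff)
    finally show "x(i := t) \<in> E" .
  qed
  then show ?thesis using x ij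
    by (auto simp: steiner_def line_length_def space_PiM PiE_def extensional_def)
qed

text \<open>Symmetrization in every coordinate makes the set invariant under all sign changes, in
  particular under the antipodal map. A point and its antipode are then at most \<open>D\<close>
  apart, which puts the set into the ball of radius \<open>D / 2\<close> about the origin. The index
  set may be empty, as happens for cross sections in dimension one.\<close>

proposition isodiametric_PiM:
  fixes I :: "'i set"
  assumes I: "finite I" and E: "E \<in> sets (Lborel_on I)" and "D \<ge> 0"
    and ED: "\<And>x y. x \<in> E \<Longrightarrow> y \<in> E \<Longrightarrow> (\<Sum>j\<in>I. (x j - y j)\<^sup>2) \<le> D\<^sup>2"
  shows "emeasure (Lborel_on I) E \<le> ennreal (unit_ball_vol (card I) * (D / 2) ^ card I)"
proof -
  have "\<exists>F\<in>sets (Lborel_on I). emeasure (Lborel_on I) F = emeasure (Lborel_on I) E \<and>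
      (\<forall>x\<in>F. \<forall>y\<in>F. (\<Sum>j\<in>I. (x j - y j)\<^sup>2) \<le> D\<^sup>2) \<and> (\<forall>x\<in>F. \<forall>j\<in>J. x(j := - x j) \<in> F)"
    if "J \<subseteq> I" for J
    using finite_subset[OF that I] that
  proof (induction J)
    case empty
    then show ?case using E ED by (intro bexI[of _ E]) auto
  next
    case (insert i J)
    from insert.prems have "J \<subseteq> I" by auto
    from insert.IH[OF this] obtain F where Fs: "F \<in> sets (Lborel_on I)"
      and Fc: "emeasure (Lborel_on I) F = emeasure (Lborel_on I) E \<and>
      (\<forall>x\<in>F. \<forall>y\<in>F. (\<Sum>j\<in>I. (x j - y j)\<^sup>2) \<le> D\<^sup>2) \<and> (\<forall>x\<in>F. \<forall>j\<in>J. x(j := - x j) \<in> F)"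
      by (rule bexE)
    note F = Fs Fc[THEN conjunct1] Fc[THEN conjunct2, THEN conjunct1, rule_format] Fc[THEN conjunct2, THEN conjunct2, rule_format]
    from insert have i: "i \<in> I" "i \<notin> J" by auto
    show ?case
    proof (intro bexI[of _ "steiner I i F"] conjI ballI)
      fix x j assume x: "x \<in> steiner I i F" and "j \<in> insert i J"
      then consider "j = i" | "j \<in> J" "i \<noteq> j" using i by auto
      then show "x(j := - x j) \<in> steiner I i F"
      proof cases
        case 1
        then show ?thesis using steiner_flip[OF x i(1)] by simp
      next
        case 2
        show ?thesis by (rule steiner_flip_other[OF F(4) x 2(2)]) (use 2 insert.prems in auto)
      qed
    next
      fix x y assume "x \<in> steiner I i F" "y \<in> steiner I i F"
      with F(3) show "(\<Sum>j\<in>I. (x j - y j)\<^sup>2) \<le> D\<^sup>2" by (rule steiner_sq_dist_le[OF I i(1)])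
    next
      show "emeasure (Lborel_on I) (steiner I i F) = emeasure (Lborel_on I) E"
        using emeasure_steiner[OF I i(1) F(1)] F(2) by simp
    next
      show "steiner I i F \<in> sets (Lborel_on I)" using F(1) i(1) by (rule sets_steiner)
    qed
  qed
  from this[OF order_refl] obtain F where Fs: "F \<in> sets (Lborel_on I)"
      and Fc: "emeasure (Lborel_on I) F = emeasure (Lborel_on I) E \<and>
      (\<forall>x\<in>F. \<forall>y\<in>F. (\<Sum>j\<in>I. (x j - y j)\<^sup>2) \<le> D\<^sup>2) \<and> (\<forall>x\<in>F. \<forall>j\<in>I. x(j := - x j) \<in> F)"
    by (rule bexE)
  note F = Fs Fc[THEN conjunct1] Fc[THEN conjunct2, THEN conjunct1, rule_format] Fc[THEN conjunct2, THEN conjunct2, rule_format]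
  have flip: "(\<lambda>j. if j \<in> J then - x j else x j) \<in> F" if "J \<subseteq> I" "x \<in> F" for x J
    using finite_subset[OF that(1) I] that
  proof (induction J)
    case (insert i J)
    have "(\<lambda>j. if j \<in> insert i J then - x j else x j) = (\<lambda>j. if j \<in> J then - x j else x j)(i := - (if i \<in> J then - x i else x i))"
      using insert.hyps by (auto simp: fun_eq_iff)
    moreover have "(\<lambda>j. if j \<in> J then - x j else x j) \<in> F" "i \<in> I"
      using insert by simp_all
    ultimately show ?case using F(4)[of "\<lambda>j. if j \<in> J then - x j else x j" i] by simp
  qed simp
  have sum_le: "(\<Sum>j\<in>I. (x j)\<^sup>2) \<le> (D / 2)\<^sup>2" if "x \<in> F" for x
  proof -
    have "(\<Sum>j\<in>I. (x j - (if j \<in> I then - x j else x j))\<^sup>2) \<le> D\<^sup>2"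
      using F(3)[OF that flip[OF order_refl that]] .
    also have "(\<Sum>j\<in>I. (x j - (if j \<in> I then - x j else x j))\<^sup>2) = 4 * (\<Sum>j\<in>I. (x j)\<^sup>2)"
      by (simp add: sum_distrib_left power2_eq_square)
    finally show ?thesis by (simp add: power_divide)
  qed
  \<comment> \<open>Radii strictly above \<open>D / 2\<close> stay positive even when
    \<open>D = 0\<close>; the sharp radius is reached as a limit.\<close>
  have bound: "emeasure (Lborel_on I) F \<le> ennreal (unit_ball_vol (card I) * r ^ card I)" if "r > D / 2" for r
  proof -
    have "r > 0" using that \<open>D \<ge> 0\<close> by simp
    have "F \<subseteq> {f. sqrt (\<Sum>i\<in>I. (f i)\<^sup>2) \<le> r} \<inter> space (Lborel_on I)"
    proof
      fix x assume "x \<in> F"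
      then have "(\<Sum>j\<in>I. (x j)\<^sup>2) \<le> r\<^sup>2"
        using sum_le[OF \<open>x \<in> F\<close>] power_mono[of "D / 2" r 2] that \<open>D \<ge> 0\<close> by linarith
      then show "x \<in> {f. sqrt (\<Sum>i\<in>I. (f i)\<^sup>2) \<le> r} \<inter> space (Lborel_on I)"
        using \<open>x \<in> F\<close> sets.sets_into_space[OF F(1)] \<open>r > 0\<close> real_le_lsqrt[of r "\<Sum>i\<in>I. (x i)\<^sup>2"] by (simp add: subset_iff)
    qed
    then have "emeasure (Lborel_on I) F \<le> emeasure (Lborel_on I) ({f. sqrt (\<Sum>i\<in>I. (f i)\<^sup>2) \<le> r} \<inter> space (Lborel_on I))"
      by (intro emeasure_mono) auto
    then show ?thesis using emeasure_cball_aux[OF I \<open>r > 0\<close>] by simp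
  qed
  have "((\<lambda>r. ennreal (unit_ball_vol (card I) * r ^ card I)) \<longlongrightarrow> ennreal (unit_ball_vol (card I) * (D / 2) ^ card I)) (at_right (D / 2))"
    by (intro tendsto_intros tendsto_ennrealI)
  then show ?thesis
  proof (rule tendsto_lowerbound)
    show "\<forall>\<^sub>F r in at_right (D / 2). emeasure (Lborel_on I) E \<le> ennreal (unit_ball_vol (card I) * r ^ card I)"
      unfolding F(2)[symmetric] eventually_at_filter using bound by (intro always_eventually) simp
  qed simp
qed

section \<open>Efficient covers by small balls\<close>

lemma countable_sequence_cover:
  fixes C :: "('a::euclidean_space \<times> real) set"
  assumes "countable C" and C: "\<And>p. p \<in> C \<Longrightarrow> 0 \<le> snd p \<and> snd p \<le> \<eta>" and "0 \<le> \<eta>"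
  obtains c \<rho> where "\<And>i::nat. 0 \<le> \<rho> i" "\<And>i. \<rho> i \<le> \<eta>" "(\<Union>p\<in>C. cball (fst p) (snd p)) \<subseteq> (\<Union>i. cball (c i) (\<rho> i))"
    "(\<Sum>i. emeasure lborel (cball (c i) (\<rho> i))) = (\<integral>\<^sup>+ p. emeasure lborel (cball (fst p) (snd p)) \<partial>count_space C)"
proof -
  \<comment> \<open>Indices that enumerate nothing get the ball of radius 0, a null set, so the sum
    over all indices is the sum over \<open>C\<close>, be it finite or infinite.\<close>
  define q where "q i = (if i \<in> to_nat_on C ` C then from_nat_into C i else (0, 0))" for i
  have q: "q (to_nat_on C p) = p" if "p \<in> C" for p
    using assms(1) that by (simp add: q_def)
  have "0 \<le> snd (q i) \<and> snd (q i) \<le> \<eta>" for i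
    using C assms(1,3) by (cases "i \<in> to_nat_on C ` C") (auto simp: q_def)
  moreover have "(\<Union>p\<in>C. cball (fst p) (snd p)) \<subseteq> (\<Union>i. cball (fst (q i)) (snd (q i)))"
  proof (intro UN_least)
    fix p assume "p \<in> C"
    then show "cball (fst p) (snd p) \<subseteq> (\<Union>i. cball (fst (q i)) (snd (q i)))"
      using UN_upper[of "to_nat_on C p" UNIV "\<lambda>i. cball (fst (q i)) (snd (q i))"] by (simp add: q)
  qed
  moreover have "(\<Sum>i. emeasure lborel (cball (fst (q i)) (snd (q i)))) = (\<integral>\<^sup>+ p. emeasure lborel (cball (fst p) (snd p)) \<partial>count_space C)"
  proof -
    have bij: "bij_betw (to_nat_on C) C (to_nat_on C ` C)"
      using assms(1) by (simp add: inj_on_imp_bij_betw inj_on_to_nat_on)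
    have "(\<Sum>i. emeasure lborel (cball (fst (q i)) (snd (q i)))) = (\<integral>\<^sup>+ i. emeasure lborel (cball (fst (q i)) (snd (q i))) \<partial>count_space UNIV)"
      by (simp add: nn_integral_count_space_nat)
    also have "\<dots> = (\<integral>\<^sup>+ i. emeasure lborel (cball (fst (q i)) (snd (q i))) * indicator (to_nat_on C ` C) i \<partial>count_space UNIV)"
      by (intro nn_integral_cong) (auto simp: q_def emeasure_cball indicator_def)
    also have "\<dots> = (\<integral>\<^sup>+ i. emeasure lborel (cball (fst (q i)) (snd (q i))) \<partial>count_space (to_nat_on C ` C))"
      by (simp add: nn_integral_count_space_indicator)
    also have "\<dots> = (\<integral>\<^sup>+ p. emeasure lborel (cball (fst (q (to_nat_on C p))) (snd (q (to_nat_on C p)))) \<partial>count_space C)"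
      by (rule nn_integral_bij_count_space[OF bij, symmetric])
    also have "\<dots> = (\<integral>\<^sup>+ p. emeasure lborel (cball (fst p) (snd p)) \<partial>count_space C)"
      by (intro nn_integral_cong) (simp add: q)
    finally show ?thesis .
  qed
  ultimately show ?thesis by (intro that[of "\<lambda>i. snd (q i)" "\<lambda>i. fst (q i)"]) auto
qed

lemma emeasure_le_add_Diff:
  assumes "A \<in> sets M" "B \<in> sets M"
  shows "emeasure M B \<le> emeasure M A + emeasure M (B - A)"
proof -
  have "emeasure M B \<le> emeasure M (A \<union> (B - A))" using assms by (intro emeasure_mono) auto
  also have "\<dots> \<le> emeasure M A + emeasure M (B - A)" using assms by (intro emeasure_subadditive) auto
  finally show ?thesis .
qed

lemma disjoint_balls_total:
  fixes U :: "'a::euclidean_space set"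
  assumes "countable C" "U \<in> sets borel" "\<And>p. p \<in> C \<Longrightarrow> cball (fst p) (snd p) \<subseteq> U"
    and "pairwise (\<lambda>i j. disjnt (cball (fst i) (snd i)) (cball (fst j) (snd j))) C"
  shows "(\<integral>\<^sup>+ p. emeasure lborel (cball (fst p) (snd p)) \<partial>count_space C) \<le> emeasure lborel U"
proof -
  have "(\<integral>\<^sup>+ p. emeasure lborel (cball (fst p) (snd p)) \<partial>count_space C) = emeasure lborel (\<Union>p\<in>C. cball (fst p) (snd p))"
    using assms by (subst emeasure_UN_countable)
      (auto simp: disjoint_family_on_def pairwise_def disjnt_def)
  also have "\<dots> \<le> emeasure lborel U" using assms by (intro emeasure_mono) auto
  finally show ?thesis .
qed

text \<open>Vitali's theorem packs disjoint balls into an open neighbourhood of \<open>S\<close>,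
  which bounds their total volume, but it misses a null set \<open>N\<close>. Hausdorff measure
  needs every point covered, so \<open>N\<close> is put into an open set \<open>V\<close> of tiny
  measure and covered by 5-fold enlargements of disjoint balls in \<open>V\<close>.\<close>

proposition small_ball_cover:
  fixes S :: "'a::euclidean_space set"
  assumes S: "S \<in> sets borel" and "\<eta> > 0" "\<epsilon> > 0"
  obtains c \<rho> where "\<And>i::nat. 0 \<le> \<rho> i" "\<And>i. \<rho> i \<le> \<eta>" "S \<subseteq> (\<Union>i. cball (c i) (\<rho> i))"
    "(\<Sum>i. emeasure lborel (cball (c i) (\<rho> i))) \<le> emeasure lborel S + ennreal \<epsilon>"
proof -
  let ?b = "\<lambda>p::'a \<times> real. cball (fst p) (snd p)"
  let ?d = "DIM('a)"
  \<comment> \<open>Enlarging radii 5 times multiplies volumes by \<open>5 ^ ?d\<close>; with this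
    choice the cover of the null set costs at most \<open>\<epsilon> / 2\<close>.\<close>
  define \<delta> where "\<delta> = \<epsilon> / (2 * 5 ^ ?d)"
  have "\<delta> > 0" using \<open>\<epsilon> > 0\<close> by (simp add: \<delta>_def)
  have open_ball: "\<exists>r>0. r < d \<and> cball x r \<subseteq> V" if V: "open V" "x \<in> V" "d > 0" for x :: 'a and V d
  proof -
    obtain e where "e > 0" "cball x e \<subseteq> V" using V open_contains_cball by blast
    then show ?thesis using V by (intro exI[of _ "min e (d / 2)"]) (auto simp: subset_iff)
  qed
  obtain U where U: "open U" "S \<subseteq> U" "emeasure lborel (U - S) < ennreal (\<epsilon> / 2)"
    using outer_regular_lborel[OF S, of "\<epsilon> / 2"] \<open>\<epsilon> > 0\<close> by auto
  define K where "K = {p :: 'a \<times> real. 0 < snd p \<and> snd p \<le> \<eta> \<and> ?b p \<subseteq> U}"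
  have "\<exists>i. i \<in> K \<and> x \<in> cball (fst i) (snd i) \<and> snd i < d" if xd: "x \<in> S" "d > 0" for x d
  proof -
    obtain r where "r > 0" "r < min d \<eta>" "cball x r \<subseteq> U" using open_ball[of U x "min d \<eta>"] xd U \<open>\<eta> > 0\<close> by auto
    then show ?thesis by (intro exI[of _ "(x, r)"]) (auto simp: K_def)
  qed
  then obtain C where C: "countable C" "C \<subseteq> K" "pairwise (\<lambda>i j. disjnt (?b i) (?b j)) C"
    and neg: "negligible (S - (\<Union>i\<in>C. ?b i))"
    by (rule Vitali_covering_theorem_cballs[of K snd S fst, rotated]) (auto simp: K_def)
  define N where "N = S - (\<Union>i\<in>C. ?b i)"
  have "N \<in> sets borel" unfolding N_def using S C(1) by (intro sets.Diff sets.countable_UN') auto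
  with neg have N: "emeasure lborel N = 0"
    by (simp add: N_def negligible_iff_emeasure0)
  obtain V where V: "open V" "N \<subseteq> V" "emeasure lborel (V - N) < ennreal \<delta>"
    using outer_regular_lborel[OF \<open>N \<in> sets borel\<close> \<open>\<delta> > 0\<close>] by auto
  have "emeasure lborel V \<le> emeasure lborel N + emeasure lborel (V - N)"
    using \<open>N \<in> sets borel\<close> V by (intro emeasure_le_add_Diff) auto
  then have emV: "emeasure lborel V \<le> ennreal \<delta>" using V N by simp
  define L where "L = {p :: 'a \<times> real. 0 < snd p \<and> snd p \<le> \<eta> / 5 \<and> ?b p \<subseteq> V}"
  have "N \<subseteq> (\<Union>p\<in>L. ?b p)"
  proof
    fix x assume "x \<in> N"
    then obtain r where "r > 0" "r < \<eta> / 5" "cball x r \<subseteq> V" using open_ball[of V x "\<eta> / 5"] V \<open>\<eta> > 0\<close> by auto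
    then show "x \<in> (\<Union>p\<in>L. ?b p)" by (intro UN_I[of "(x, r)"]) (auto simp: L_def)
  qed
  then obtain D where D: "countable D" "D \<subseteq> L" "pairwise (\<lambda>i j. disjnt (?b i) (?b j)) D"
    "N \<subseteq> (\<Union>p\<in>D. cball (fst p) (5 * snd p))"
    by (rule Vitali_covering_lemma_cballs[of N fst snd L "\<eta> / 5"]) (auto simp: L_def)
  let ?e = "\<lambda>p::'a \<times> real. (fst p, 5 * snd p)"
  have "(\<integral>\<^sup>+ p. emeasure lborel (?b p) \<partial>count_space C) \<le> emeasure lborel U"
    using C U by (intro disjoint_balls_total) (auto simp: K_def)
  also have "\<dots> \<le> emeasure lborel S + emeasure lborel (U - S)"
    using S U by (intro emeasure_le_add_Diff) auto
  also have "\<dots> \<le> emeasure lborel S + ennreal (\<epsilon> / 2)" using U by (intro add_left_mono) auto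
  finally have sum1: "(\<integral>\<^sup>+ p. emeasure lborel (?b p) \<partial>count_space C) \<le> emeasure lborel S + ennreal (\<epsilon> / 2)" .
  have "inj_on ?e D" by (auto simp: inj_on_def prod_eq_iff)
  then have bij: "bij_betw ?e D (?e ` D)" by (simp add: inj_on_imp_bij_betw)
  have "(\<integral>\<^sup>+ p. emeasure lborel (?b p) \<partial>count_space (?e ` D)) = (\<integral>\<^sup>+ p. emeasure lborel (?b (?e p)) \<partial>count_space D)"
    by (rule nn_integral_bij_count_space[OF bij, symmetric])
  also have "\<dots> = (\<integral>\<^sup>+ p. ennreal (5 ^ ?d) * emeasure lborel (?b p) \<partial>count_space D)"
    using D(2) by (intro nn_integral_cong) (auto simp: emeasure_cball L_def ennreal_mult[symmetric] power_mult_distrib mult_ac)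
  also have "\<dots> = ennreal (5 ^ ?d) * (\<integral>\<^sup>+ p. emeasure lborel (?b p) \<partial>count_space D)"
    by (rule nn_integral_cmult) simp
  also have "\<dots> \<le> ennreal (5 ^ ?d) * emeasure lborel V"
    using D V by (intro mult_left_mono disjoint_balls_total) (auto simp: L_def)
  also have "\<dots> \<le> ennreal (5 ^ ?d) * ennreal \<delta>" using emV by (intro mult_left_mono) auto
  also have "\<dots> = ennreal (\<epsilon> / 2)" using \<open>\<epsilon> > 0\<close> by (simp add: ennreal_mult[symmetric] \<delta>_def)
  finally have sum2: "(\<integral>\<^sup>+ p. emeasure lborel (?b p) \<partial>count_space (?e ` D)) \<le> ennreal (\<epsilon> / 2)" .
  have Cb: "0 \<le> snd p \<and> snd p \<le> \<eta>" if "p \<in> C \<union> ?e ` D" for p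
    using that C(2) D(2) by (auto simp: K_def L_def)
  have Cc: "countable (C \<union> ?e ` D)" using C(1) D(1) by simp
  obtain c \<rho> where 1: "\<And>i::nat. 0 \<le> \<rho> i" "\<And>i. \<rho> i \<le> \<eta>"
    "(\<Union>p\<in>C \<union> ?e ` D. ?b p) \<subseteq> (\<Union>i. cball (c i) (\<rho> i))"
    "(\<Sum>i. emeasure lborel (cball (c i) (\<rho> i))) = (\<integral>\<^sup>+ p. emeasure lborel (?b p) \<partial>count_space (C \<union> ?e ` D))"
    by (rule countable_sequence_cover[OF Cc Cb less_imp_le[OF \<open>\<eta> > 0\<close>]]) (assumption, rule that)
  show ?thesis
  proof (rule that[OF 1(1,2)])
    have "(\<Union>p\<in>C. ?b p) \<union> N \<subseteq> (\<Union>p\<in>C \<union> ?e ` D. ?b p)" using D(4) by auto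
    moreover have "S \<subseteq> (\<Union>p\<in>C. ?b p) \<union> N" by (auto simp: N_def)
    ultimately show "S \<subseteq> (\<Union>i. cball (c i) (\<rho> i))" using 1(3) by (meson subset_trans)
    have "(\<integral>\<^sup>+ p. emeasure lborel (?b p) \<partial>count_space (C \<union> ?e ` D)) \<le>
       (\<integral>\<^sup>+ p. emeasure lborel (?b p) * indicator C p + emeasure lborel (?b p) * indicator (?e ` D) p \<partial>count_space UNIV)"
      by (subst nn_integral_count_space_indicator) (auto intro!: nn_integral_mono simp: indicator_def)
    also have "\<dots> = (\<integral>\<^sup>+ p. emeasure lborel (?b p) \<partial>count_space C) + (\<integral>\<^sup>+ p. emeasure lborel (?b p) \<partial>count_space (?e ` D))"
      by (simp add: nn_integral_add nn_integral_count_space_indicator)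
    also have "\<dots> \<le> (emeasure lborel S + ennreal (\<epsilon> / 2)) + ennreal (\<epsilon> / 2)" using sum1 sum2 by (rule add_mono)
    also have "\<dots> = emeasure lborel S + ennreal \<epsilon>" using \<open>\<epsilon> > 0\<close> by (simp add: add.assoc ennreal_plus[symmetric] del: ennreal_plus)
    finally show "(\<Sum>i. emeasure lborel (cball (c i) (\<rho> i))) \<le> emeasure lborel S + ennreal \<epsilon>" using 1(4) by simp
  qed
qed

section \<open>Hausdorff measure and Lebesgue measure\<close>

text \<open>For \<open>n = 0\<close> the convention \<open>0 ^ 0 = 1\<close> reproduces the separate
  case of the gauge, so natural powers serve in all dimensions, including d - 1 = 0.\<close>

lemma hausdorff_gauge_nat:
  "hausdorff_gauge (real n) E = (if E = {} then 0 else ennreal (unit_ball_vol n * (diameter E / 2) ^ n))" if "bounded E"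
  using diameter_ge_0[OF that] by (cases "n = 0") (auto simp: hausdorff_gauge_def powr_realpow' intro!: arg_cong[where f=ennreal])

lemma hausdorff_gauge_le:
  assumes "bounded E" "0 \<le> D" "\<And>x y. x \<in> E \<Longrightarrow> y \<in> E \<Longrightarrow> dist x y \<le> D"
  shows "hausdorff_gauge (real n) E \<le> ennreal (unit_ball_vol n * (D / 2) ^ n)"
proof -
  have "diameter E \<le> D" using assms unfolding diameter_def by (auto intro!: cSUP_least)
  then have "(diameter E / 2) ^ n \<le> (D / 2) ^ n" using diameter_ge_0[OF \<open>bounded E\<close>] by (intro power_mono) auto
  then show ?thesis using assms(1) by (auto simp: hausdorff_gauge_nat intro!: ennreal_leI mult_left_mono)
qed

lemma hausdorff_premeasure_le:
  assumes "S \<subseteq> (\<Union>i. E i)" "\<And>i::nat. bounded (E i)" "\<And>i. diameter (E i) \<le> \<delta>"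
  shows "hausdorff_premeasure t \<delta> S \<le> (\<Sum>i. hausdorff_gauge t (E i))"
  unfolding hausdorff_premeasure_def using assms by (intro Inf_lower) auto

lemma hausdorff_premeasure_le_measure:
  "\<delta> > 0 \<Longrightarrow> hausdorff_premeasure t \<delta> S \<le> hausdorff_measure t S"
  unfolding hausdorff_measure_def by (intro SUP_upper) auto

lemma hausdorff_measure_leI:
  assumes "\<And>\<delta>. \<delta> > 0 \<Longrightarrow> hausdorff_premeasure t \<delta> S \<le> c"
  shows "hausdorff_measure t S \<le> c"
  unfolding hausdorff_measure_def using assms by (intro SUP_least) auto

lemma hausdorff_cover_exists:
  assumes "hausdorff_measure t S < c" "\<delta> > 0"
  obtains E where "S \<subseteq> (\<Union>i::nat. E i)" "\<And>i. bounded (E i)" "\<And>i. diameter (E i) \<le> \<delta>"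
    "(\<Sum>i. hausdorff_gauge t (E i)) < c"
proof -
  have "hausdorff_premeasure t \<delta> S < c" using hausdorff_premeasure_le_measure[OF assms(2)] assms(1) by (rule order_le_less_trans)
  then show ?thesis unfolding hausdorff_premeasure_def Inf_less_iff using that by auto
qed

lemma hausdorff_measure_mono:
  assumes "S \<subseteq> T"
  shows "hausdorff_measure t S \<le> hausdorff_measure t T"
proof (rule hausdorff_measure_leI)
  fix \<delta> :: real assume "\<delta> > 0"
  have "hausdorff_premeasure t \<delta> S \<le> hausdorff_premeasure t \<delta> T"
    unfolding hausdorff_premeasure_def
  proof (rule Inf_superset_mono, rule subsetI, unfold mem_Collect_eq, elim exE conjE)
    fix x and E :: "nat \<Rightarrow> 'a set"
    assume "x = (\<Sum>i. hausdorff_gauge t (E i))" "T \<subseteq> (\<Union>i. E i)" "\<forall>i. bounded (E i) \<and> diameter (E i) \<le> \<delta>"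
    then show "\<exists>E. x = (\<Sum>i. hausdorff_gauge t (E i)) \<and> S \<subseteq> (\<Union>i. E i) \<and> (\<forall>i. bounded (E i) \<and> diameter (E i) \<le> \<delta>)"
      using assms by (intro exI[of _ E]) auto
  qed
  also have "\<dots> \<le> hausdorff_measure t T" using \<open>\<delta> > 0\<close> by (rule hausdorff_premeasure_le_measure)
  finally show "hausdorff_premeasure t \<delta> S \<le> hausdorff_measure t T" .
qed

lemma hausdorff_measure_empty [simp]: "hausdorff_measure t {} = 0"
proof -
  have "hausdorff_premeasure t \<delta> ({}::'a set) \<le> (\<Sum>i. hausdorff_gauge t ({}::'a set))" if "\<delta> > 0" for \<delta>
    using that by (intro hausdorff_premeasure_le) auto
  then have "hausdorff_measure t ({}::'a set) \<le> 0" by (intro hausdorff_measure_leI) (simp add: hausdorff_gauge_def)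
  then show ?thesis by simp
qed

text \<open>The images of the sets of a cover have no larger diameters. Applied to reflections, this
  yields the invariance of Lebesgue measure by way of Hausdorff measure.\<close>

lemma hausdorff_measure_image_le:
  fixes f :: "'a::metric_space \<Rightarrow> 'b::metric_space"
  assumes f: "\<And>x y. dist (f x) (f y) \<le> dist x y"
  shows "hausdorff_measure (real n) (f ` S) \<le> hausdorff_measure (real n) S"
proof (rule hausdorff_measure_leI)
  fix \<delta> :: real assume "\<delta> > 0"
  show "hausdorff_premeasure n \<delta> (f ` S) \<le> hausdorff_measure n S"
  proof (rule dense_ge)
    fix c assume c: "hausdorff_measure n S < c"
    obtain E where E: "S \<subseteq> (\<Union>i::nat. E i)" "\<And>i. bounded (E i)" "\<And>i. diameter (E i) \<le> \<delta>"
      "(\<Sum>i. hausdorff_gauge n (E i)) < c"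
      by (rule hausdorff_cover_exists[OF c \<open>\<delta> > 0\<close>]) (rule that)
    have d: "dist x y \<le> diameter (E i)" if xy: "x \<in> f ` E i" "y \<in> f ` E i" for x y i
    proof -
      obtain x' y' where "x' \<in> E i" "y' \<in> E i" "x = f x'" "y = f y'" using xy by auto
      then show ?thesis using f[of x' y'] diameter_bounded_bound[OF E(2), of x' i y'] by simp
    qed
    have b: "bounded (f ` E i)" for i
      unfolding bounded_two_points using d by blast
    have di: "diameter (f ` E i) \<le> diameter (E i)" for i
      using d[of _ i] diameter_ge_0[OF E(2)[of i]] by (auto simp: diameter_def[of "f ` E i"] intro!: cSUP_least)
    have "hausdorff_premeasure n \<delta> (f ` S) \<le> (\<Sum>i. hausdorff_gauge n (f ` E i))"
    proof (rule hausdorff_premeasure_le)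
      show "f ` S \<subseteq> (\<Union>i. f ` E i)" using E(1) by blast
      show "diameter (f ` E i) \<le> \<delta>" for i using di[of i] E(3)[of i] by simp
    qed (fact b)
    also have "\<dots> \<le> (\<Sum>i. hausdorff_gauge n (E i))"
    proof (intro suminf_le)
      fix i
      show "hausdorff_gauge n (f ` E i) \<le> hausdorff_gauge n (E i)"
      proof (cases "E i = {}")
        case False
        then show ?thesis using hausdorff_gauge_le[OF b diameter_ge_0[OF E(2)] d, of i i n] by (simp add: hausdorff_gauge_nat[OF E(2)])
      qed (simp add: hausdorff_gauge_def)
    qed auto
    also have "\<dots> \<le> c" using E by simp
    finally show "hausdorff_premeasure n \<delta> (f ` S) \<le> c" .
  qed
qed

section \<open>Agreement with Lebesgue measure in the top dimension\<close>

lemma emeasure_lborel_PiM: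
  fixes C :: "'a::euclidean_space set"
  assumes "C \<in> sets borel"
  shows "emeasure lborel C = emeasure (Lborel_on Basis) ((\<lambda>f. \<Sum>b\<in>Basis. f b *\<^sub>R b) -` C \<inter> space (Lborel_on Basis))"
  using assms by (subst lborel_eq) (auto simp: emeasure_distr)

lemma sum_Basis_inner:
  "b \<in> Basis \<Longrightarrow> (\<Sum>b'\<in>Basis. f b' *\<^sub>R b') \<bullet> (b :: 'a::euclidean_space) = f b"
  by (simp add: inner_sum_left inner_Basis if_distrib cong: if_cong)

proposition isodiametric:
  fixes C :: "'a::euclidean_space set"
  assumes C: "C \<in> sets borel" and "0 \<le> D" and D: "\<And>x y. x \<in> C \<Longrightarrow> y \<in> C \<Longrightarrow> dist x y \<le> D"
  shows "emeasure lborel C \<le> ennreal (unit_ball_vol DIM('a) * (D / 2) ^ DIM('a))"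
  unfolding emeasure_lborel_PiM[OF C]
proof (rule isodiametric_PiM)
  show "(\<lambda>f. \<Sum>b\<in>Basis. f b *\<^sub>R b) -` C \<inter> space (Lborel_on Basis) \<in> sets (Lborel_on Basis)"
    using C by measurable
  fix x y :: "'a \<Rightarrow> real"
  assume "x \<in> (\<lambda>f. \<Sum>b\<in>Basis. f b *\<^sub>R b) -` C \<inter> space (Lborel_on Basis)"
    "y \<in> (\<lambda>f. \<Sum>b\<in>Basis. f b *\<^sub>R b) -` C \<inter> space (Lborel_on Basis)"
  then have "dist (\<Sum>b\<in>Basis. x b *\<^sub>R b) (\<Sum>b\<in>Basis. y b *\<^sub>R b) \<le> D" using D by auto
  then have "sqrt (\<Sum>b\<in>Basis. (x b - y b)\<^sup>2) \<le> D"
    by (subst (asm) euclidean_dist_l2) (simp add: L2_set_def sum_Basis_inner dist_real_def)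
  then show "(\<Sum>b\<in>Basis. (x b - y b)\<^sup>2) \<le> D\<^sup>2" using sqrt_le_D by blast
qed (use assms in auto)

text \<open>The isodiametric inequality bounds the volume of each covering set by its gauge; as
  covering sets are arbitrary, their closures are measured, which have the same diameter. Conversely
  the gauge of a ball is exactly its volume, and balls cover \<open>S\<close> at a total volume
  arbitrarily close to that of \<open>S\<close>.\<close>

theorem hausdorff_measure_eq_lborel:
  fixes S :: "'a::euclidean_space set"
  assumes S: "S \<in> sets borel"
  shows "hausdorff_measure (real DIM('a)) S = emeasure lborel S"
proof (rule antisym)
  let ?d = "DIM('a)"
  show "emeasure lborel S \<le> hausdorff_measure ?d S"
  proof (rule dense_ge)
    fix c assume c: "hausdorff_measure ?d S < c"
    obtain E where E: "S \<subseteq> (\<Union>i::nat. E i)" "\<And>i. bounded (E i)" "\<And>i. diameter (E i) \<le> 1"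
      "(\<Sum>i. hausdorff_gauge ?d (E i)) < c"
      by (rule hausdorff_cover_exists[OF c zero_less_one]) (rule that)
    have "emeasure lborel S \<le> emeasure lborel (\<Union>i. closure (E i))"
    proof (rule emeasure_mono)
      show "S \<subseteq> (\<Union>i. closure (E i))" using E(1) closure_subset by blast
    qed (auto intro!: sets.countable_UN')
    also have "\<dots> \<le> (\<Sum>i. emeasure lborel (closure (E i)))" by (intro emeasure_subadditive_countably) auto
    also have "\<dots> \<le> (\<Sum>i. hausdorff_gauge ?d (E i))"
    proof (intro suminf_le)
      fix i
      show "emeasure lborel (closure (E i)) \<le> hausdorff_gauge ?d (E i)"
      proof (cases "E i = {}")
        case False
        have "dist x y \<le> diameter (E i)" if "x \<in> closure (E i)" "y \<in> closure (E i)" for x y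
          using diameter_bounded_bound[OF bounded_closure[OF E(2)] that] by (simp add: diameter_closure[OF E(2)])
        then show ?thesis using False diameter_ge_0[OF E(2)]
          by (auto simp: hausdorff_gauge_nat[OF E(2)] intro!: isodiametric)
      qed simp
    qed auto
    also have "\<dots> \<le> c" using E by simp
    finally show "emeasure lborel S \<le> c" .
  qed
  show "hausdorff_measure ?d S \<le> emeasure lborel S"
  proof (rule hausdorff_measure_leI, rule ennreal_le_epsilon)
    fix \<delta> \<epsilon> :: real assume "\<delta> > 0" "\<epsilon> > 0"
    obtain c \<rho> where c: "\<And>i::nat. 0 \<le> \<rho> i" "\<And>i. \<rho> i \<le> \<delta> / 2" "S \<subseteq> (\<Union>i. cball (c i) (\<rho> i))"
      "(\<Sum>i. emeasure lborel (cball (c i) (\<rho> i))) \<le> emeasure lborel S + ennreal \<epsilon>"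
      by (rule small_ball_cover[OF S half_gt_zero[OF \<open>\<delta> > 0\<close>] \<open>\<epsilon> > 0\<close>]) (rule that)
    have "hausdorff_premeasure ?d \<delta> S \<le> (\<Sum>i. hausdorff_gauge ?d (cball (c i) (\<rho> i)))"
    proof (rule hausdorff_premeasure_le[OF c(3)])
      show "diameter (cball (c i) (\<rho> i)) \<le> \<delta>" for i using c(1,2)[of i] by simp
    qed simp
    also have "\<dots> = (\<Sum>i. emeasure lborel (cball (c i) (\<rho> i)))"
    proof (intro suminf_cong)
      show "hausdorff_gauge ?d (cball (c i) (\<rho> i)) = emeasure lborel (cball (c i) (\<rho> i))" for i
        using c(1)[of i] by (simp add: hausdorff_gauge_nat emeasure_cball)
    qed
    also note c(4)
    finally show "hausdorff_premeasure ?d \<delta> S \<le> emeasure lborel S + ennreal \<epsilon>" .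
  qed
qed

section \<open>Cylinders and slices of balls\<close>

text \<open>The identity for \<open>w = 0\<close>, because \<open>x / 0 = 0\<close>.\<close>

definition householder :: "'a::euclidean_space \<Rightarrow> 'a \<Rightarrow> 'a" where
  "householder w x = x - (2 * (x \<bullet> w) / (w \<bullet> w)) *\<^sub>R w"

lemma householder_inner: "householder w x \<bullet> householder w y = x \<bullet> y"
  by (cases "w = 0") (auto simp: householder_def inner_diff_left inner_diff_right inner_commute field_simps)

lemma householder_diff: "householder w x - householder w y = householder w (x - y)"
  by (simp add: householder_def inner_diff_left algebra_simps diff_divide_distrib)

lemma norm_householder: "norm (householder w x) = norm x"
  by (simp add: norm_eq_sqrt_inner householder_inner)

lemma dist_householder: "dist (householder w x) (householder w y) = dist x y"
  by (simp add: dist_norm householder_diff norm_householder)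

lemma householder_involution [simp]: "householder w (householder w x) = x"
  by (cases "w = 0") (auto simp: householder_def inner_diff_left algebra_simps)

text \<open>For unit vectors the reflection along \<open>u - e\<close> exchanges \<open>u\<close>
  and \<open>e\<close> and preserves inner products. It serves to turn an arbitrary direction into a
  coordinate direction.\<close>

lemma householder_inner_unit:
  assumes "norm u = 1" "norm e = 1"
  shows "householder (u - e) x \<bullet> e = x \<bullet> u"
proof (cases "u = e")
  case False
  have u: "u \<bullet> u = 1" "e \<bullet> e = 1" using assms by (simp_all add: norm_eq_1)
  then have ww: "(u - e) \<bullet> (u - e) = 2 * (1 - u \<bullet> e)" by (simp add: inner_diff_left inner_diff_right inner_commute)
  with False have q: "1 - u \<bullet> e \<noteq> 0" by (metis inner_eq_zero_iff mult_zero_right right_minus_eq)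
  have "householder (u - e) x \<bullet> e = x \<bullet> e - (2 * (x \<bullet> u - x \<bullet> e) / (2 * (1 - u \<bullet> e))) * (u \<bullet> e - 1)"
    unfolding householder_def ww by (simp only: inner_diff_left inner_diff_right inner_scaleR_left u)
  also have "\<dots> = x \<bullet> u"
  proof -
    have "b - (2 * (a - b) / (2 * (1 - c))) * (c - 1) = a" if "1 - c \<noteq> 0" for a b c :: real
      using that by (simp add: divide_simps) (simp add: algebra_simps)
    from this[OF q] show ?thesis .
  qed
  finally show ?thesis .
qed (simp add: householder_def)

text \<open>A reflection does not increase Hausdorff measure, here equal to Lebesgue measure, and it
  is its own inverse; the two inequalities give equality.\<close>

lemma emeasure_householder:
  fixes C :: "'a::euclidean_space set"
  assumes "closed C"
  shows "closed (householder w ` C)" "emeasure lborel (householder w ` C) = emeasure lborel C"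
proof -
  have le: "emeasure lborel (householder w ` F) \<le> emeasure lborel F"
    if "F \<in> sets borel" "householder w ` F \<in> sets borel" for F :: "'a set"
    using hausdorff_measure_image_le[of "householder w" "DIM('a)" F] that
    by (simp add: dist_householder hausdorff_measure_eq_lborel)
  have "householder w ` C = householder w -` C"
    by (auto simp: image_iff) (metis householder_involution)
  moreover have "continuous_on UNIV (householder w)"
    unfolding householder_def by (cases "w = 0") (auto intro!: continuous_intros)
  ultimately show cl: "closed (householder w ` C)"
    using assms by (metis continuous_closed_vimage continuous_on_eq_continuous_at open_UNIV UNIV_I)
  have "householder w ` householder w ` C = C" by (auto simp: image_iff)
  then show "emeasure lborel (householder w ` C) = emeasure lborel C"
    using le[of C] le[of "householder w ` C"] cl assms by (intro antisym) auto
qed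

lemma inner_self_Basis_remove:
  fixes v e :: "'a::euclidean_space"
  assumes "e \<in> Basis"
  shows "(norm v)\<^sup>2 - (v \<bullet> e)\<^sup>2 = (\<Sum>b\<in>Basis - {e}. (v \<bullet> b)\<^sup>2)"
proof -
  have "(norm v)\<^sup>2 = (\<Sum>b\<in>Basis. (v \<bullet> b)\<^sup>2)"
    unfolding power2_norm_eq_inner by (subst euclidean_inner) (simp add: power2_eq_square)
  then show ?thesis using assms by (simp add: sum.remove)
qed

text \<open>Tonelli along \<open>e\<close>: a slice at fixed height, written in the remaining
  coordinates, has diameter at most \<open>D\<close>, so the isodiametric inequality in dimension d
  - 1 bounds it; integration over the height interval gives the volume.\<close>

lemma emeasure_cylinder_Basis:
  fixes C :: "'a::euclidean_space set"
  assumes C: "closed C" and e: "e \<in> Basis" and "0 \<le> D"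
    and D: "\<And>x y. x \<in> C \<Longrightarrow> y \<in> C \<Longrightarrow> (norm (x - y))\<^sup>2 - ((x - y) \<bullet> e)\<^sup>2 \<le> D\<^sup>2"
    and h: "\<And>x. x \<in> C \<Longrightarrow> \<alpha> \<le> x \<bullet> e \<and> x \<bullet> e \<le> \<beta>" and "\<alpha> \<le> \<beta>"
  shows "emeasure lborel C \<le> ennreal ((\<beta> - \<alpha>) * (unit_ball_vol (real (DIM('a) - 1)) * (D / 2) ^ (DIM('a) - 1)))"
proof -
  define J where "J = Basis - {e}"
  have J: "finite J" "e \<notin> J" "insert e J = Basis" "card J = DIM('a) - 1" using e by (auto simp: J_def)
  define w where "w = unit_ball_vol (real (DIM('a) - 1)) * (D / 2) ^ (DIM('a) - 1)"
  have "w \<ge> 0" using \<open>0 \<le> D\<close> by (simp add: w_def)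
  let ?s = "\<lambda>f. \<Sum>b\<in>Basis. f b *\<^sub>R b :: 'a"
  interpret product_sigma_finite "\<lambda>_. lborel" by standard
  define Q where "Q = ?s -` C \<inter> space (Lborel_on Basis)"
  have Q: "Q \<in> sets (Lborel_on Basis)" unfolding Q_def using C by measurable
  define R where "R t = (\<lambda>x. x(e := t)) -` Q \<inter> space (Lborel_on J)" for t
  have upd: "(\<lambda>x. x(e := t)) \<in> Lborel_on J \<rightarrow>\<^sub>M Lborel_on Basis" for t
    using J by (intro measurable_fun_upd[where J=J]) auto
  have R: "R t \<in> sets (Lborel_on J)" for t unfolding R_def using Q upd by measurable
  have slice: "emeasure (Lborel_on J) (R t) \<le> ennreal w * indicator {\<alpha>..\<beta>} t" for t
  proof (cases "t \<in> {\<alpha>..\<beta>}")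
    case True
    have "emeasure (Lborel_on J) (R t) \<le> ennreal (unit_ball_vol (card J) * (D / 2) ^ card J)"
    proof (rule isodiametric_PiM[OF J(1) R \<open>0 \<le> D\<close>])
      fix x y assume "x \<in> R t" "y \<in> R t"
      then have "?s (x(e := t)) \<in> C" "?s (y(e := t)) \<in> C" by (auto simp: R_def Q_def)
      from D[OF this] have "(\<Sum>b\<in>J. ((?s (x(e := t)) - ?s (y(e := t))) \<bullet> b)\<^sup>2) \<le> D\<^sup>2"
        unfolding inner_self_Basis_remove[OF e] J_def .
      also have "(\<Sum>b\<in>J. ((?s (x(e := t)) - ?s (y(e := t))) \<bullet> b)\<^sup>2) = (\<Sum>b\<in>J. (x b - y b)\<^sup>2)"
      proof (intro sum.cong refl)
        fix b assume "b \<in> J"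
        then have "b \<in> Basis" "b \<noteq> e" by (auto simp: J_def)
        then show "((?s (x(e := t)) - ?s (y(e := t))) \<bullet> b)\<^sup>2 = (x b - y b)\<^sup>2"
          by (simp add: inner_diff_left sum_Basis_inner del: fun_upd_apply) simp
      qed
      finally show "(\<Sum>b\<in>J. (x b - y b)\<^sup>2) \<le> D\<^sup>2" .
    qed
    then show ?thesis using True J by (simp add: w_def)
  next
    case False
    have "R t = {}"
    proof (rule ccontr)
      assume "R t \<noteq> {}"
      then obtain x where "?s (x(e := t)) \<in> C" by (auto simp: R_def Q_def)
      from h[OF this] show False using False by (simp add: sum_Basis_inner[OF e] del: fun_upd_apply) simp
    qed
    then show ?thesis by simp
  qed
  have "emeasure lborel C = emeasure (Lborel_on Basis) Q"
    unfolding Q_def using C by (intro emeasure_lborel_PiM) auto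
  also have "\<dots> = (\<integral>\<^sup>+ x. indicator Q x \<partial>Lborel_on (insert e J))" using Q J(3) by simp
  also have "\<dots> = (\<integral>\<^sup>+ t. \<integral>\<^sup>+ x. indicator Q (x(e := t)) \<partial>Lborel_on J \<partial>lborel)"
    using Q J by (intro product_nn_integral_insert_rev) auto
  also have "\<dots> = (\<integral>\<^sup>+ t. emeasure (Lborel_on J) (R t) \<partial>lborel)"
  proof (intro nn_integral_cong)
    fix t :: real
    have "(\<integral>\<^sup>+ x. indicator Q (x(e := t)) \<partial>Lborel_on J) = (\<integral>\<^sup>+ x. indicator (R t) x \<partial>Lborel_on J)"
      by (intro nn_integral_cong) (auto simp: R_def indicator_def)
    then show "(\<integral>\<^sup>+ x. indicator Q (x(e := t)) \<partial>Lborel_on J) = emeasure (Lborel_on J) (R t)" using R by simp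
  qed
  also have "\<dots> \<le> (\<integral>\<^sup>+ t. ennreal w * indicator {\<alpha>..\<beta>} t \<partial>lborel)"
    by (intro nn_integral_mono slice)
  also have "\<dots> = ennreal ((\<beta> - \<alpha>) * w)"
    using \<open>w \<ge> 0\<close> \<open>\<alpha> \<le> \<beta>\<close> by (simp add: nn_integral_cmult_indicator ennreal_mult[symmetric] mult.commute)
  finally show ?thesis by (simp add: w_def)
qed

text \<open>\<open>F\<close> is an arbitrary set. The conditions on width and height are closed,
  hence pass to its closure, which is measurable; a reflection then moves \<open>u\<close> to a
  basis vector.\<close>

proposition emeasure_cylinder:
  fixes F :: "'a::euclidean_space set"
  assumes u: "norm u = 1" and "0 \<le> D"
    and D: "\<And>x y. x \<in> F \<Longrightarrow> y \<in> F \<Longrightarrow> (norm (x - y))\<^sup>2 - ((x - y) \<bullet> u)\<^sup>2 \<le> D\<^sup>2"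
    and h: "\<And>x. x \<in> F \<Longrightarrow> \<alpha> \<le> x \<bullet> u \<and> x \<bullet> u \<le> \<beta>" and "\<alpha> \<le> \<beta>"
  shows "emeasure lborel (closure F) \<le> ennreal ((\<beta> - \<alpha>) * (unit_ball_vol (real (DIM('a) - 1)) * (D / 2) ^ (DIM('a) - 1)))"
proof -
  \<comment> \<open>The width condition involves two points and is extended to the closure in one
    argument at a time.\<close>
  have *: "closure F \<subseteq> {y. (norm (x - y))\<^sup>2 - ((x - y) \<bullet> u)\<^sup>2 \<le> D\<^sup>2}" if "x \<in> F" for x
    using D that by (intro closure_minimal closed_Collect_le continuous_intros) auto
  have "closure F \<subseteq> {x. (norm (x - y))\<^sup>2 - ((x - y) \<bullet> u)\<^sup>2 \<le> D\<^sup>2}" if "y \<in> closure F" for y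
    using * that by (intro closure_minimal closed_Collect_le continuous_intros) auto
  then have D': "(norm (x - y))\<^sup>2 - ((x - y) \<bullet> u)\<^sup>2 \<le> D\<^sup>2" if "x \<in> closure F" "y \<in> closure F" for x y
    using that by blast
  have "closure F \<subseteq> {x. \<alpha> \<le> x \<bullet> u} \<inter> {x. x \<bullet> u \<le> \<beta>}"
    using h by (intro closure_minimal closed_Int closed_Collect_le continuous_intros) auto
  then have h': "\<alpha> \<le> x \<bullet> u \<and> x \<bullet> u \<le> \<beta>" if "x \<in> closure F" for x using that by blast
  obtain e :: 'a where e: "e \<in> Basis" by (meson nonempty_Basis ex_in_conv)
  let ?f = "householder (u - e)"
  have fe: "?f x \<bullet> e = x \<bullet> u" for x using u e by (intro householder_inner_unit) auto
  have "emeasure lborel (closure F) = emeasure lborel (?f ` closure F)"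
    by (simp add: emeasure_householder)
  also have "\<dots> \<le> ennreal ((\<beta> - \<alpha>) * (unit_ball_vol (real (DIM('a) - 1)) * (D / 2) ^ (DIM('a) - 1)))"
  proof (rule emeasure_cylinder_Basis[OF _ e \<open>0 \<le> D\<close> _ _ \<open>\<alpha> \<le> \<beta>\<close>])
    show "closed (?f ` closure F)" by (simp add: emeasure_householder)
    show "\<And>x. x \<in> ?f ` closure F \<Longrightarrow> \<alpha> \<le> x \<bullet> e \<and> x \<bullet> e \<le> \<beta>" using h' by (auto simp: fe)
    show "\<And>x y. x \<in> ?f ` closure F \<Longrightarrow> y \<in> ?f ` closure F \<Longrightarrow> (norm (x - y))\<^sup>2 - ((x - y) \<bullet> e)\<^sup>2 \<le> D\<^sup>2"
      using D' by (auto simp: householder_diff norm_householder fe)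
  qed
  finally show ?thesis .
qed

text \<open>
  The volume of the slice at height \<open>t\<close> of an \<open>(n+1)\<close>-dimensional ball of radius \<open>\<rho>\<close>; for \<open>n = 0\<close>
  and \<open>\<bar>t\<bar> = \<rho>\<close> it is \<open>0 ^ 0 = 1\<close>, in accordance with counting measure.
\<close>

definition slice_vol :: "nat \<Rightarrow> real \<Rightarrow> real \<Rightarrow> real" where
  "slice_vol n \<rho> t = (if \<bar>t\<bar> \<le> \<rho> then unit_ball_vol (real n) * sqrt (\<rho>\<^sup>2 - t\<^sup>2) ^ n else 0)"

lemma slice_vol_measurable [measurable]: "slice_vol n \<rho> \<in> borel_measurable borel"
  unfolding slice_vol_def by measurable

text \<open>The Beta factor is the integral of \<open>sqrt (1 - t\<^sup>2) ^ n\<close> over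
  \<open>{-1..1}\<close>: this is the recursion obtained by slicing a ball with parallel
  hyperplanes.\<close>

lemma unit_ball_vol_Suc: "unit_ball_vol (real (Suc n)) = unit_ball_vol (real n) * Beta (1 / 2) (real n / 2 + 1)"
  by (auto simp: unit_ball_vol_def Beta_def Gamma_eq_zero_iff field_simps
      Gamma_one_half_real powr_half_sqrt [symmetric] powr_add [symmetric])

text \<open>Cavalieri's principle for a ball. It converts gauges of slices in dimension
  \<open>n\<close> into volumes in dimension \<open>Suc n\<close> without loss of a
  constant.\<close>

lemma nn_integral_slice_vol:
  assumes "0 \<le> \<rho>"
  shows "(\<integral>\<^sup>+ t. ennreal (slice_vol n \<rho> (t - a)) \<partial>lborel) = ennreal (unit_ball_vol (real (Suc n)) * \<rho> ^ Suc n)"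
proof (cases "\<rho> = 0")
  case True
  have "(\<integral>\<^sup>+ t. ennreal (slice_vol n \<rho> (t - a)) \<partial>lborel) = (\<integral>\<^sup>+ (t::real). 0 \<partial>lborel)"
    \<comment> \<open>The integrand can be nonzero only at the single point \<open>a\<close>, and is
      so for \<open>n = 0\<close>.\<close>
    by (intro nn_integral_cong_AE AE_I[of _ _ "{a}"]) (auto simp: slice_vol_def True)
  then show ?thesis using True by simp
next
  case False
  with assms have \<rho>: "\<rho> > 0" by simp
  have sc: "ennreal (slice_vol n \<rho> (a + \<rho> * t - a)) = ennreal (unit_ball_vol n * \<rho> ^ n) * ennreal (indicator {-1..1} t * sqrt (1 - t\<^sup>2) ^ n)" for t
  proof -
    have "sqrt (\<rho>\<^sup>2 - (\<rho> * t)\<^sup>2) = \<rho> * sqrt (1 - t\<^sup>2)"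
    proof -
      have "\<rho>\<^sup>2 - (\<rho> * t)\<^sup>2 = \<rho>\<^sup>2 * (1 - t\<^sup>2)" by (simp add: power_mult_distrib right_diff_distrib)
      then show ?thesis using \<rho> by (simp add: real_sqrt_mult)
    qed
    moreover have "\<bar>\<rho> * t\<bar> \<le> \<rho> \<longleftrightarrow> \<bar>t\<bar> \<le> 1" using \<rho> by (simp add: abs_mult)
    ultimately show ?thesis using \<rho>
      by (auto simp: slice_vol_def indicator_def power_mult_distrib ennreal_mult'[symmetric] mult_ac)
  qed
  have "(\<integral>\<^sup>+ t. ennreal (slice_vol n \<rho> (t - a)) \<partial>lborel) = ennreal \<rho> * (\<integral>\<^sup>+ t. ennreal (slice_vol n \<rho> (a + \<rho> * t - a)) \<partial>lborel)"
    using \<rho> by (subst nn_integral_real_affine[where c=\<rho> and t=a]) auto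
  also have "\<dots> = ennreal \<rho> * (ennreal (unit_ball_vol n * \<rho> ^ n) * ennreal (Beta (1 / 2) (real n / 2 + 1)))"
    unfolding sc emeasure_cball_aux_integral[symmetric] by (subst nn_integral_cmult) auto
  also have "\<dots> = ennreal (unit_ball_vol (real (Suc n)) * \<rho> ^ Suc n)"
    unfolding unit_ball_vol_Suc using \<rho> by (simp add: ennreal_mult'[symmetric] mult_ac)
  finally show ?thesis .
qed

section \<open>The distance function along segments to nearest points\<close>

lemma norm_le_square_average:
  fixes w :: "'a::real_normed_vector" and s :: real
  assumes "s > 0" shows "norm w \<le> ((norm w)\<^sup>2 + s\<^sup>2) / (2 * s)"
proof -
  have "0 \<le> (norm w - s)\<^sup>2" by simp
  then show ?thesis using assms by (simp add: field_simps power2_eq_square)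
qed

text \<open>The square root in the norm is replaced by its quadratic majorant touching at the value
  \<open>s\<close>. The bound holds for all \<open>v\<close>, not only small ones, and its constant
  is half the curvature of a sphere of radius \<open>s\<close>.\<close>

lemma norm_plus_scaleR_unit_le:
  fixes v \<nu> :: "'a::real_inner"
  assumes "norm \<nu> = 1" "s > 0"
  shows "norm (v + s *\<^sub>R \<nu>) \<le> s + v \<bullet> \<nu> + (norm v)\<^sup>2 / (2 * s)"
proof -
  have "(norm (v + s *\<^sub>R \<nu>))\<^sup>2 = (norm v)\<^sup>2 + 2 * s * (v \<bullet> \<nu>) + s\<^sup>2"
    using assms unfolding power2_norm_eq_inner by (simp add: inner_add_left inner_add_right inner_commute norm_eq_1 power2_eq_square)
  with norm_le_square_average[OF \<open>s > 0\<close>, of "v + s *\<^sub>R \<nu>"]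
  show ?thesis using assms by (simp add: field_simps power2_eq_square)
qed

lemma infdist_on_segment:
  fixes a \<nu> :: "'a::real_normed_vector"
  assumes "a \<in> A" "norm \<nu> = 1" "infdist (a + \<rho> *\<^sub>R \<nu>) A = \<rho>" "0 \<le> \<sigma>" "\<sigma> \<le> \<rho>"
  shows "infdist (a + \<sigma> *\<^sub>R \<nu>) A = \<sigma>"
proof (rule antisym)
  show "infdist (a + \<sigma> *\<^sub>R \<nu>) A \<le> \<sigma>"
    using infdist_le[OF assms(1), of "a + \<sigma> *\<^sub>R \<nu>"] assms by (simp add: dist_norm)
  have "dist (a + \<rho> *\<^sub>R \<nu>) (a + \<sigma> *\<^sub>R \<nu>) = \<rho> - \<sigma>"
    using assms by (simp add: dist_norm scaleR_diff_left[symmetric])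
  then show "\<sigma> \<le> infdist (a + \<sigma> *\<^sub>R \<nu>) A"
    using infdist_triangle[of "a + \<rho> *\<^sub>R \<nu>" A "a + \<sigma> *\<^sub>R \<nu>"] assms by simp
qed

definition quadratic_tangent :: "('a::real_inner \<Rightarrow> real) \<Rightarrow> real \<Rightarrow> 'a \<Rightarrow> 'a \<Rightarrow> bool" where
  "quadratic_tangent f K x \<nu> \<longleftrightarrow> (\<forall>y. \<bar>f y - f x - (y - x) \<bullet> \<nu>\<bar> \<le> K * (norm (y - x))\<^sup>2)"

lemma quadratic_tangentD: "quadratic_tangent f K x \<nu> \<Longrightarrow> \<bar>f y - f x - (y - x) \<bullet> \<nu>\<bar> \<le> K * (norm (y - x))\<^sup>2"
  by (simp add: quadratic_tangent_def)

text \<open>The distance to \<open>A\<close> is at most the distance to \<open>a\<close>, and at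
  least \<open>\<rho>\<close> minus the distance to the outer end
  \<open>a + \<rho> *\<^sub>R \<nu>\<close>. Both bounds are exact at the point
  \<open>a + \<sigma> *\<^sub>R \<nu>\<close> with gradient \<open>\<nu>\<close>; the spheres
  involved have radii \<open>\<sigma>\<close> and \<open>\<rho> - \<sigma>\<close>, whence the two
  conditions on \<open>K\<close>.\<close>

lemma infdist_quadratic_tangent:
  fixes a \<nu> :: "'a::real_inner"
  assumes A: "a \<in> A" "norm \<nu> = 1" "infdist (a + \<rho> *\<^sub>R \<nu>) A = \<rho>" and \<sigma>: "0 < \<sigma>" "\<sigma> < \<rho>"
    and K: "1 / (2 * \<sigma>) \<le> K" "1 / (2 * (\<rho> - \<sigma>)) \<le> K"
  shows "quadratic_tangent (\<lambda>x. infdist x A) K (a + \<sigma> *\<^sub>R \<nu>) \<nu>"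
  unfolding quadratic_tangent_def
proof
  fix y
  define x v where "x = a + \<sigma> *\<^sub>R \<nu>" and "v = y - x"
  have dx: "infdist x A = \<sigma>" unfolding x_def using infdist_on_segment[OF A] \<sigma> by simp
  have "infdist y A \<le> norm (v + \<sigma> *\<^sub>R \<nu>)"
    using infdist_le[OF A(1), of y] by (simp add: dist_norm v_def x_def algebra_simps)
  also have "\<dots> \<le> \<sigma> + v \<bullet> \<nu> + (norm v)\<^sup>2 * (1 / (2 * \<sigma>))"
    using norm_plus_scaleR_unit_le[OF A(2) \<sigma>(1), of v] by simp
  also have "\<dots> \<le> \<sigma> + v \<bullet> \<nu> + (norm v)\<^sup>2 * K" using K by (intro add_left_mono mult_left_mono) auto
  finally have 1: "infdist y A - \<sigma> - v \<bullet> \<nu> \<le> K * (norm v)\<^sup>2" by (simp add: mult.commute)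
  have "\<rho> - infdist y A \<le> norm (- v + (\<rho> - \<sigma>) *\<^sub>R \<nu>)"
    using infdist_triangle[of "a + \<rho> *\<^sub>R \<nu>" A y] A by (simp add: dist_norm v_def x_def algebra_simps)
  also have "\<dots> \<le> (\<rho> - \<sigma>) - v \<bullet> \<nu> + (norm v)\<^sup>2 * (1 / (2 * (\<rho> - \<sigma>)))"
    using norm_plus_scaleR_unit_le[OF A(2), of "\<rho> - \<sigma>" "- v"] \<sigma> by simp
  also have "\<dots> \<le> (\<rho> - \<sigma>) - v \<bullet> \<nu> + (norm v)\<^sup>2 * K" using K by (intro add_left_mono mult_left_mono) auto
  finally have 2: "- (infdist y A - \<sigma> - v \<bullet> \<nu>) \<le> K * (norm v)\<^sup>2" by (simp add: mult.commute)
  from 1 2 dx show "\<bar>infdist y A - infdist (a + \<sigma> *\<^sub>R \<nu>) A - (y - (a + \<sigma> *\<^sub>R \<nu>)) \<bullet> \<nu>\<bar> \<le> K * (norm (y - (a + \<sigma> *\<^sub>R \<nu>)))\<^sup>2"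
    by (simp add: x_def[symmetric] v_def[symmetric] abs_le_iff)
qed

text \<open>Both tangents are tested at a point \<open>y\<close> displaced from \<open>x'\<close> by
  \<open>l\<close> in the direction of \<open>\<nu>' - \<nu>\<close>. The error at \<open>y\<close>
  seen from \<open>x\<close> is at most \<open>4 * K * l\<^sup>2\<close>, that at \<open>y\<close>
  seen from \<open>x'\<close> and that at \<open>x'\<close> seen from \<open>x\<close> at most
  \<open>K * l\<^sup>2\<close> each: together the factor 6.\<close>

lemma quadratic_tangent_lipschitz:
  fixes f :: "'a::real_inner \<Rightarrow> real"
  assumes x: "quadratic_tangent f K x \<nu>" "quadratic_tangent f K x' \<nu>'" and "0 \<le> K"
  shows "norm (\<nu>' - \<nu>) \<le> 6 * K * norm (x' - x)"
proof -
  \<comment> \<open>A length strictly above \<open>norm (x' - x)\<close> is positive even for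
    \<open>x' = x\<close>, so the displacement is never trivial.\<close>
  have *: "norm (\<nu>' - \<nu>) \<le> 6 * K * l" if l: "norm (x' - x) < l" for l
  proof (cases "\<nu>' = \<nu>")
    case True
    have "0 \<le> l" using l norm_ge_zero[of "x' - x"] by linarith
    then show ?thesis using True \<open>0 \<le> K\<close> by simp
  next
    case False
    have "l > 0" using l norm_ge_zero[of "x' - x"] by linarith
    define e where "e = (\<nu>' - \<nu>) /\<^sub>R norm (\<nu>' - \<nu>)"
    have e: "norm e = 1" "e \<bullet> (\<nu>' - \<nu>) = norm (\<nu>' - \<nu>)"
      using False by (auto simp: e_def power2_norm_eq_inner[symmetric] power2_eq_square)
    define y where "y = x' + l *\<^sub>R e"
    have ny: "norm (y - x') = l" using e \<open>l > 0\<close> by (simp add: y_def)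
    have "norm (y - x) \<le> norm (y - x') + norm (x' - x)" using norm_triangle_ineq[of "y - x'" "x' - x"] by simp
    then have nyx: "norm (y - x) \<le> 2 * l" using ny l by simp
    have "(norm (y - x))\<^sup>2 \<le> (2 * l)\<^sup>2" using nyx by (intro power_mono) auto
    then have "K * (norm (y - x))\<^sup>2 \<le> K * (4 * l\<^sup>2)" using \<open>0 \<le> K\<close> by (intro mult_left_mono) (auto simp: power_mult_distrib)
    moreover have "K * (norm (x' - x))\<^sup>2 \<le> K * l\<^sup>2" using \<open>0 \<le> K\<close> l by (intro mult_left_mono power_mono) auto
    moreover have "(y - x) \<bullet> \<nu> = (x' - x) \<bullet> \<nu> + l * (e \<bullet> \<nu>)" "(y - x') \<bullet> \<nu>' = l * (e \<bullet> \<nu>')"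
      by (simp_all add: y_def inner_diff_left inner_add_left)
    moreover have "l * (e \<bullet> \<nu>') - l * (e \<bullet> \<nu>) = l * norm (\<nu>' - \<nu>)"
      using e(2) by (simp add: inner_diff_right right_diff_distrib[symmetric])
    ultimately have "l * norm (\<nu>' - \<nu>) \<le> 6 * (K * l\<^sup>2)"
      using quadratic_tangentD[OF x(1), of y] quadratic_tangentD[OF x(2), of y] quadratic_tangentD[OF x(1), of x'] ny
      by (simp add: abs_le_iff)
    then have "l * norm (\<nu>' - \<nu>) \<le> l * (6 * K * l)" by (simp add: power2_eq_square mult_ac)
    then show ?thesis using \<open>l > 0\<close> by simp
  qed
  show ?thesis
  proof (cases "K = 0")
    case True
    then show ?thesis using *[of "norm (x' - x) + 1"] by simp
  next
    case False
    show ?thesis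
    proof (rule dense_ge)
      fix m assume m: "6 * K * norm (x' - x) < m"
      then have "norm (x' - x) < m / (6 * K)" using False \<open>0 \<le> K\<close> by (simp add: field_simps)
      from *[OF this] show "norm (\<nu>' - \<nu>) \<le> m" using False by simp
    qed
  qed
qed

text \<open>The hypotheses say that \<open>a\<close> is nearest to \<open>a + w\<close>, and \<open>a'\<close> to \<open>a' + w'\<close>, among the two points \<open>a\<close>, \<open>a'\<close>.\<close>

lemma segment_contraction:
  fixes a a' w w' :: "'a::real_inner"
  assumes "norm w \<le> norm (a + w - a')" "norm w' \<le> norm (a' + w' - a)" and \<theta>: "0 \<le> \<theta>" "\<theta> \<le> 1"
  shows "\<theta> * norm ((a + w) - (a' + w')) \<le> norm ((a + \<theta> *\<^sub>R w) - (a' + \<theta> *\<^sub>R w'))"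
proof -
  define b v where "b = a - a'" and "v = w - w'"
  have "(norm w)\<^sup>2 \<le> (norm (b + w))\<^sup>2" "(norm w')\<^sup>2 \<le> (norm (w' - b))\<^sup>2"
    using assms by (auto intro!: power_mono simp: b_def algebra_simps)
  then have "0 \<le> b \<bullet> b + 2 * (b \<bullet> w)" "0 \<le> b \<bullet> b - 2 * (b \<bullet> w')"
    by (simp_all add: power2_norm_eq_inner inner_simps inner_commute)
  \<comment> \<open>Half the sum of the two nearest-point conditions. In the identity below this
    sign suffices, because all coefficients are nonnegative for \<open>\<theta>\<close> between 0
    and 1.\<close>
  then have bv: "0 \<le> b \<bullet> b + b \<bullet> v" by (simp add: v_def inner_diff_right)
  have "(norm (b + \<theta> *\<^sub>R v))\<^sup>2 - \<theta>\<^sup>2 * (norm (b + v))\<^sup>2 = (1 - \<theta>)\<^sup>2 * (b \<bullet> b) + 2 * \<theta> * (1 - \<theta>) * (b \<bullet> b + b \<bullet> v)"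
    unfolding power2_norm_eq_inner by (simp add: inner_simps inner_commute power2_eq_square algebra_simps)
  also have "\<dots> \<ge> 0" using \<theta> bv by simp
  finally have "(\<theta> * norm (b + v))\<^sup>2 \<le> (norm (b + \<theta> *\<^sub>R v))\<^sup>2" by (simp add: power_mult_distrib)
  then have "\<theta> * norm (b + v) \<le> norm (b + \<theta> *\<^sub>R v)" by (rule power2_le_imp_le) simp
  then show ?thesis by (simp add: b_def v_def algebra_simps)
qed

lemma infdist_segment_contraction:
  fixes a a' \<nu> \<nu>' :: "'a::real_inner"
  assumes A: "a \<in> A" "norm \<nu> = 1" "infdist (a + \<rho> *\<^sub>R \<nu>) A = \<rho>"
    and A': "a' \<in> A" "norm \<nu>' = 1" "infdist (a' + \<rho> *\<^sub>R \<nu>') A = \<rho>" and "0 < \<rho>" "0 \<le> \<sigma>" "\<sigma> \<le> \<rho>"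
  shows "\<sigma> / \<rho> * norm ((a + \<rho> *\<^sub>R \<nu>) - (a' + \<rho> *\<^sub>R \<nu>')) \<le> norm ((a + \<sigma> *\<^sub>R \<nu>) - (a' + \<sigma> *\<^sub>R \<nu>'))"
proof -
  have "norm (\<rho> *\<^sub>R \<nu>) \<le> norm (a + \<rho> *\<^sub>R \<nu> - a')" "norm (\<rho> *\<^sub>R \<nu>') \<le> norm (a' + \<rho> *\<^sub>R \<nu>' - a)"
    using infdist_le[OF A'(1), of "a + \<rho> *\<^sub>R \<nu>"] infdist_le[OF A(1), of "a' + \<rho> *\<^sub>R \<nu>'"] A A' \<open>0 < \<rho>\<close> by (simp_all add: dist_norm)
  from segment_contraction[OF this, of "\<sigma> / \<rho>"] show ?thesis using assms by simp
qed

section \<open>Flatness of level sets inside a small ball\<close>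

definition perp :: "'a::real_inner \<Rightarrow> 'a \<Rightarrow> 'a" where
  "perp u w = w - (w \<bullet> u) *\<^sub>R u"

lemma perp_diff: "perp u (v - w) = perp u v - perp u w"
  by (simp add: perp_def inner_diff_left algebra_simps)

lemma perp_scaleR: "perp u (c *\<^sub>R w) = c *\<^sub>R perp u w"
  by (simp add: perp_def algebra_simps)

lemma norm_perp_sq: "norm u = 1 \<Longrightarrow> (norm (perp u w))\<^sup>2 = (norm w)\<^sup>2 - (w \<bullet> u)\<^sup>2"
  unfolding power2_norm_eq_inner by (simp add: perp_def inner_simps inner_commute norm_eq_1 power2_eq_square)

lemma norm_perp_le: "norm u = 1 \<Longrightarrow> norm (perp u w) \<le> norm w"
  using norm_perp_sq[of u w] by (auto intro: power2_le_imp_le[of "norm (perp u w)" "norm w"])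

lemma norm_perp_unit_le: "norm u = 1 \<Longrightarrow> norm (perp u w) \<le> norm (w - u)"
  using norm_perp_le[of u "w - u"] by (simp add: perp_diff) (simp add: perp_def norm_eq_1)

lemma norm_le_perp:
  assumes "norm u = 1" shows "norm w \<le> norm (perp u w) + \<bar>w \<bullet> u\<bar>"
  using norm_triangle_ineq[of "perp u w" "(w \<bullet> u) *\<^sub>R u"] assms by (simp add: perp_def)

text \<open>Up to \<open>O(K \<rho>\<^sup>2)\<close>, level sets inside a ball are flat, hence no wider than slices of a slightly larger ball.\<close>

lemma level_set_in_ball:
  fixes f :: "'a::real_inner \<Rightarrow> real"
  assumes q: "quadratic_tangent f K x\<^sub>0 u" and u: "norm u = 1" and "0 \<le> K" and x0: "x\<^sub>0 \<in> cball c \<rho>"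
    and x: "x \<in> cball c \<rho>" "x' \<in> cball c \<rho>" "f x = \<sigma>" "f x' = \<sigma>"
  defines "\<rho>' \<equiv> \<rho> * (1 + 8 * K * \<rho>)" and "s \<equiv> f x\<^sub>0 + (c - x\<^sub>0) \<bullet> u"
  shows "\<bar>\<sigma> - s\<bar> \<le> \<rho>' \<and> norm (x - x') \<le> 2 * sqrt (\<rho>'\<^sup>2 - (\<sigma> - s)\<^sup>2)"
proof -
  \<comment> \<open>Points of the ball lie within \<open>2 * \<rho>\<close> of
    \<open>x\<^sub>0\<close>, so \<open>K * (2 * \<rho>)\<^sup>2\<close> bounds the error of the
    tangent throughout the ball. The number \<open>s\<close> is the value at the centre
    \<open>c\<close> of the affine tangent function.\<close>
  define \<delta> where "\<delta> = 4 * K * \<rho>\<^sup>2"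
  have \<rho>: "0 \<le> \<rho>" using x0 by (meson dist_not_less_zero linorder_not_less mem_cball order_le_less_trans)
  have \<delta>: "0 \<le> \<delta>" using \<open>0 \<le> K\<close> by (simp add: \<delta>_def)
  have \<rho>': "\<rho>' = \<rho> + 2 * \<delta>" by (simp add: \<rho>'_def \<delta>_def power2_eq_square algebra_simps)
  have h: "\<bar>\<sigma> - s - (y - c) \<bullet> u\<bar> \<le> \<delta>" if y: "y \<in> cball c \<rho>" "f y = \<sigma>" for y
  proof -
    have "norm (y - x\<^sub>0) \<le> norm (y - c) + norm (c - x\<^sub>0)" using norm_triangle_ineq[of "y - c" "c - x\<^sub>0"] by simp
    also have "\<dots> \<le> 2 * \<rho>" using y x0 by (simp add: dist_norm norm_minus_commute)
    finally have "(norm (y - x\<^sub>0))\<^sup>2 \<le> (2 * \<rho>)\<^sup>2" by (intro power_mono) auto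
    then have "K * (norm (y - x\<^sub>0))\<^sup>2 \<le> \<delta>" using mult_left_mono[OF _ \<open>0 \<le> K\<close>] by (fastforce simp: \<delta>_def power_mult_distrib)
    moreover have "f y - f x\<^sub>0 - (y - x\<^sub>0) \<bullet> u = \<sigma> - s - (y - c) \<bullet> u" using y by (simp add: s_def inner_diff_left)
    ultimately show ?thesis using quadratic_tangentD[OF q, of y] by simp
  qed
  \<comment> \<open>The radius \<open>\<rho> + 2 * \<delta>\<close> leaves room to shift the
    components orthogonal to \<open>u\<close> and along \<open>u\<close> by \<open>\<delta>\<close>
    each. When the bounds for two points are added, the spare terms pay for their height difference,
    at most \<open>2 * \<delta>\<close>.\<close>
  have *: "\<bar>\<sigma> - s\<bar> \<le> \<rho>' \<and> norm (perp u (y - c)) + \<delta> \<le> sqrt (\<rho>'\<^sup>2 - (\<sigma> - s)\<^sup>2)" if y: "y \<in> cball c \<rho>" "f y = \<sigma>" for y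
  proof -
    define p k where "p = norm (perp u (y - c))" and "k = \<bar>(y - c) \<bullet> u\<bar>"
    have "norm (y - c) \<le> \<rho>" using y by (simp add: dist_norm norm_minus_commute)
    then have "(norm (y - c))\<^sup>2 \<le> \<rho>\<^sup>2" by (intro power_mono) auto
    then have pk: "p\<^sup>2 + k\<^sup>2 \<le> \<rho>\<^sup>2" by (simp add: p_def k_def norm_perp_sq[OF u])
    have pk0: "0 \<le> p" "0 \<le> k" by (auto simp: p_def k_def)
    have "p\<^sup>2 \<le> \<rho>\<^sup>2" "k\<^sup>2 \<le> \<rho>\<^sup>2" using pk zero_le_power2[of p] zero_le_power2[of k] by linarith+
    then have pk\<rho>: "p \<le> \<rho>" "k \<le> \<rho>" using \<rho> power2_le_imp_le[of p \<rho>] power2_le_imp_le[of k \<rho>] by blast+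
    have sk: "\<bar>\<sigma> - s\<bar> \<le> k + \<delta>" using h[OF y] by (simp add: k_def)
    then have "(\<sigma> - s)\<^sup>2 \<le> (k + \<delta>)\<^sup>2" using pk0 \<delta> by (metis abs_le_square_iff abs_of_nonneg add_nonneg_nonneg)
    moreover have "(p + \<delta>)\<^sup>2 + (k + \<delta>)\<^sup>2 \<le> \<rho>'\<^sup>2"
    proof -
      have "\<delta> * (p + k) \<le> \<delta> * (2 * \<rho>)" using \<delta> pk\<rho> by (intro mult_left_mono) auto
      moreover have "(p + \<delta>)\<^sup>2 + (k + \<delta>)\<^sup>2 = (p\<^sup>2 + k\<^sup>2) + 2 * (\<delta> * (p + k)) + 2 * \<delta>\<^sup>2"
        "\<rho>'\<^sup>2 = \<rho>\<^sup>2 + 2 * (\<delta> * (2 * \<rho>)) + 4 * \<delta>\<^sup>2"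
        unfolding \<rho>' by (simp_all add: power2_eq_square algebra_simps)
      ultimately show ?thesis using pk zero_le_power2[of \<delta>] by linarith
    qed
    ultimately have "(p + \<delta>)\<^sup>2 \<le> \<rho>'\<^sup>2 - (\<sigma> - s)\<^sup>2" by simp
    then have "p + \<delta> \<le> sqrt (\<rho>'\<^sup>2 - (\<sigma> - s)\<^sup>2)" by (rule real_le_rsqrt)
    moreover have "\<bar>\<sigma> - s\<bar> \<le> \<rho>'" using sk pk\<rho> \<delta> by (simp add: \<rho>')
    ultimately show ?thesis by (simp add: p_def)
  qed
  have "\<bar>(x - x') \<bullet> u\<bar> \<le> 2 * \<delta>"
    using h[OF x(1,3)] h[OF x(2,4)] by (simp add: inner_diff_left abs_le_iff)
  moreover have "norm (perp u (x - x')) \<le> norm (perp u (x - c)) + norm (perp u (x' - c))"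
    using norm_triangle_ineq4[of "perp u (x - c)" "perp u (x' - c)"] by (simp add: perp_diff[symmetric])
  ultimately show ?thesis
    using *[OF x(1,3)] *[OF x(2,4)] norm_le_perp[OF u, of "x - x'"] by linarith
qed

section \<open>Surface area is bounded by the left derivative of the volume\<close>

lemma exists_le_average:
  fixes g :: "real \<Rightarrow> ennreal"
  assumes [measurable]: "g \<in> borel_measurable borel" and I: "(\<integral>\<^sup>+ t. g t \<partial>lborel) \<le> ennreal M" and "0 \<le> M" "M < M'" "a < b"
  obtains t where "a < t" "t < b" "g t \<le> ennreal (M' / (b - a))"
proof (rule ccontr)
  assume "\<not> thesis"
  then have g: "ennreal (M' / (b - a)) \<le> g t" if "a < t" "t < b" for t
    using that \<open>\<not> thesis\<close> by (meson linear \<open>\<And>t. a < t \<Longrightarrow> t < b \<Longrightarrow> g t \<le> ennreal (M' / (b - a)) \<Longrightarrow> thesis\<close>)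
  have "ennreal M' = ennreal (M' / (b - a)) * emeasure lborel {a<..<b}"
    using assms by (simp add: ennreal_mult[symmetric])
  also have "\<dots> = (\<integral>\<^sup>+ t. ennreal (M' / (b - a)) * indicator {a<..<b} t \<partial>lborel)"
    by (simp add: nn_integral_cmult_indicator)
  also have "\<dots> \<le> (\<integral>\<^sup>+ t. g t \<partial>lborel)" using g by (intro nn_integral_mono) (auto simp: indicator_def)
  also note I
  finally show False using assms by (simp add: ennreal_le_iff2)
qed

text \<open>
  Balls covering the annulus are cut by the level sets \<open>{infdist x A = s}\<close>. Moving along the segments
  to the nearest points identifies a subset of each level \<open>s\<close> with the whole level \<open>r\<close>, with
  distances expanded by at most \<open>r / s\<close>. Averaging over \<open>s\<close> the gauges of the cuts gives the volumes of the balls,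
  so some level \<open>s\<close> provides an efficient cover.
\<close>

lemma hausdorff_level_set_cover:
  fixes A :: "'a::euclidean_space set"
  assumes A: "closed A" "A \<noteq> {}" and t: "0 < t" "0 < \<kappa>" "t + \<kappa> < r"
    and K: "1 / (2 * t) \<le> K" "1 / (2 * (r - (t + \<kappa>))) \<le> K"
    and \<tau>: "emeasure lborel {x. t < infdist x A \<and> infdist x A < t + \<kappa>} = ennreal \<tau>" "0 \<le> \<tau>"
    and \<eta>: "0 < \<eta>" "2 * (r / t) * (\<eta> * (1 + 8 * K * \<eta>)) \<le> \<delta>"
  defines "n \<equiv> DIM('a) - 1"
  shows "hausdorff_premeasure n \<delta> {x. infdist x A = r} \<le>
    ennreal ((r / t) ^ n * (((1 + 8 * K * \<eta>) ^ Suc n * (\<tau> + \<eta>) + \<eta>) / \<kappa>))"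
proof -
  let ?d = "\<lambda>x. infdist x A"
  define Z T where "Z = {x. ?d x = r}" and "T = {x. t < ?d x \<and> ?d x < t + \<kappa>}"
  have Sn: "Suc n = DIM('a)" by (simp add: n_def)
  have r: "0 < r" "t < r" "1 \<le> r / t" using t by auto
  have "0 < 1 / (2 * t)" using t by simp
  then have "0 \<le> K" using K by linarith
  have "\<exists>a\<in>A. ?d z = dist z a" for z using infdist_attains_inf[OF A, of z] by metis
  then obtain p where p: "\<And>z. p z \<in> A" "\<And>z. ?d z = dist z (p z)" by metis
  define \<nu> where "\<nu> z = (z - p z) /\<^sub>R r" for z
  define X where "X s z = p z + s *\<^sub>R \<nu> z" for s z
  have \<nu>: "norm (\<nu> z) = 1" and Xr: "X r z = z" and pr: "?d (p z + r *\<^sub>R \<nu> z) = r" if "z \<in> Z" for z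
    using that p(2)[of z] r by (auto simp: \<nu>_def X_def Z_def dist_norm)
  have dX: "?d (X s z) = s" if "z \<in> Z" "0 \<le> s" "s \<le> r" for s z
    unfolding X_def using that by (intro infdist_on_segment[OF p(1) \<nu> pr]) auto
  have q: "quadratic_tangent ?d K (X s z) (\<nu> z)" if "z \<in> Z" "t < s" "s < t + \<kappa>" for s z
    unfolding X_def
  proof (rule infdist_quadratic_tangent[OF p(1) \<nu> pr])
    show "1 / (2 * s) \<le> K" using that t by (intro order_trans[OF _ K(1)] divide_left_mono) auto
    show "1 / (2 * (r - s)) \<le> K" using that t by (intro order_trans[OF _ K(2)] divide_left_mono) auto
  qed (use that t in auto)
  have "open T" unfolding T_def by (intro open_Collect_conj open_Collect_less continuous_intros)
  then have "T \<in> sets borel" by simp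
  obtain c \<rho> where c: "\<And>i::nat. 0 \<le> \<rho> i" "\<And>i. \<rho> i \<le> \<eta>" "T \<subseteq> (\<Union>i. cball (c i) (\<rho> i))"
    "(\<Sum>i. emeasure lborel (cball (c i) (\<rho> i))) \<le> emeasure lborel T + ennreal \<eta>"
    by (rule small_ball_cover[OF \<open>T \<in> sets borel\<close> \<eta>(1) \<eta>(1)]) (rule that)
  define \<rho>' where "\<rho>' i = \<rho> i * (1 + 8 * K * \<rho> i)" for i
  have \<rho>': "0 \<le> \<rho>' i" "\<rho>' i \<le> \<rho> i * (1 + 8 * K * \<eta>)" for i
    using c(1,2)[of i] \<open>0 \<le> K\<close> by (auto simp: \<rho>'_def intro!: mult_left_mono)
  have \<rho>'\<eta>: "\<rho>' i \<le> \<eta> * (1 + 8 * K * \<eta>)" for i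
    using \<rho>'(2)[of i] c(2)[of i] mult_right_mono[of "\<rho> i" \<eta> "1 + 8 * K * \<eta>"] \<open>0 \<le> K\<close> \<eta>(1) by simp
  define E where "E i s = {z \<in> Z. X s z \<in> cball (c i) (\<rho> i)}" for i s
  \<comment> \<open>One offset \<open>s0\<close> must serve all levels \<open>s\<close> for a given
    ball, so that the slice volumes can be integrated in \<open>s\<close>. It is the value at the
    centre of the tangent function at any one point \<open>X s1 z1\<close> in the ball; without such
    a point all cuts are empty.\<close>
  have "\<exists>s0. \<forall>s. t < s \<longrightarrow> s < t + \<kappa> \<longrightarrow> bounded (E i s) \<and> diameter (E i s) \<le> \<delta> \<and>
     hausdorff_gauge n (E i s) \<le> ennreal ((r / t) ^ n) * ennreal (slice_vol n (\<rho>' i) (s - s0))" for i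
  proof (cases "\<exists>s z. t < s \<and> s < t + \<kappa> \<and> z \<in> E i s")
    case True
    then obtain s1 z1 where 1: "t < s1" "s1 < t + \<kappa>" "z1 \<in> E i s1" by blast
    define x\<^sub>0 u where "x\<^sub>0 = X s1 z1" and "u = \<nu> z1"
    have z1: "z1 \<in> Z" and x0: "x\<^sub>0 \<in> cball (c i) (\<rho> i)" using 1 by (auto simp: E_def x\<^sub>0_def)
    define s0 where "s0 = ?d x\<^sub>0 + (c i - x\<^sub>0) \<bullet> u"
    show ?thesis
    proof (intro exI[of _ s0] allI impI)
      fix s assume s: "t < s" "s < t + \<kappa>"
      define D where "D = sqrt ((\<rho>' i)\<^sup>2 - (s - s0)\<^sup>2)"
      have lev: "\<bar>s - s0\<bar> \<le> \<rho>' i \<and> dist z z' \<le> (r / t) * (2 * D)" if z: "z \<in> E i s" "z' \<in> E i s" for z z'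
      proof -
        have zZ: "z \<in> Z" "z' \<in> Z" "X s z \<in> cball (c i) (\<rho> i)" "X s z' \<in> cball (c i) (\<rho> i)"
          using z by (auto simp: E_def)
        have ds: "?d (X s z) = s" "?d (X s z') = s" using dX zZ s t by auto
        note L = level_set_in_ball[OF q[OF z1 1(1,2), folded x\<^sub>0_def u_def] \<nu>[OF z1, folded u_def] \<open>0 \<le> K\<close> x0 zZ(3,4) ds,
            folded \<rho>'_def s0_def, folded D_def]
        have D0: "0 \<le> D" using L norm_ge_zero[of "X s z - X s z'"] by linarith
        have "s / r * dist z z' \<le> norm (X s z - X s z')"
          using infdist_segment_contraction[OF p(1) \<nu>[OF zZ(1)] pr[OF zZ(1)] p(1) \<nu>[OF zZ(2)] pr[OF zZ(2)] r(1), of s] s t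
          unfolding X_def[symmetric] Xr[OF zZ(1)] Xr[OF zZ(2)] dist_norm by simp
        then have "s / r * dist z z' \<le> 2 * D" using L by linarith
        then have "dist z z' \<le> (r / s) * (2 * D)" using s t r by (simp add: field_simps)
        also have "\<dots> \<le> (r / t) * (2 * D)" using s t r D0 by (intro mult_right_mono divide_left_mono) auto
        finally show ?thesis using L by blast
      qed
      have bd: "bounded (E i s)" using lev unfolding bounded_two_points by blast
      show "bounded (E i s) \<and> diameter (E i s) \<le> \<delta> \<and>
         hausdorff_gauge n (E i s) \<le> ennreal ((r / t) ^ n) * ennreal (slice_vol n (\<rho>' i) (s - s0))"
      proof (cases "E i s = {}")
        case True
        have "0 \<le> \<eta> * (1 + 8 * K * \<eta>)" using \<eta>(1) \<open>0 \<le> K\<close> by simp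
        then have "0 \<le> 2 * (r / t) * (\<eta> * (1 + 8 * K * \<eta>))" using r t by simp
        then show ?thesis using True \<eta>(2) by (simp add: hausdorff_gauge_def)
      next
        case False
        then have in_rng: "\<bar>s - s0\<bar> \<le> \<rho>' i" using lev by blast
        then have "(s - s0)\<^sup>2 \<le> (\<rho>' i)\<^sup>2" using \<rho>'(1) by (simp add: power2_le_iff_abs_le)
        then have D0: "0 \<le> D" by (simp add: D_def)
        have "D \<le> sqrt ((\<rho>' i)\<^sup>2)" unfolding D_def by (intro real_sqrt_le_mono) simp
        then have D1: "D \<le> \<rho>' i" using \<rho>'(1) by simp
        have D2: "0 \<le> (r / t) * (2 * D)" using D0 r t by simp
        have "diameter (E i s) \<le> (r / t) * (2 * D)"
          using lev False by (intro diameter_le) (auto simp: dist_norm)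
        also have "\<dots> \<le> (r / t) * (2 * (\<eta> * (1 + 8 * K * \<eta>)))"
          using D1 \<rho>'\<eta>[of i] r t by (intro mult_left_mono) auto
        also have "\<dots> \<le> \<delta>" using \<eta>(2) by (simp add: mult_ac)
        finally have "diameter (E i s) \<le> \<delta>" .
        moreover have "hausdorff_gauge n (E i s) \<le> ennreal (unit_ball_vol n * ((r / t) * (2 * D) / 2) ^ n)"
          using lev by (intro hausdorff_gauge_le[OF bd D2]) blast
        moreover have "unit_ball_vol n * ((r / t) * (2 * D) / 2) ^ n = (r / t) ^ n * slice_vol n (\<rho>' i) (s - s0)"
          using in_rng by (simp add: slice_vol_def D_def power_mult_distrib power_divide)
        moreover have "ennreal ((r / t) ^ n * slice_vol n (\<rho>' i) (s - s0)) = ennreal ((r / t) ^ n) * ennreal (slice_vol n (\<rho>' i) (s - s0))"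
          using r t by (intro ennreal_mult') auto
        ultimately show ?thesis using bd by metis
      qed
    qed
  next
    case False
    have "0 \<le> \<eta> * (1 + 8 * K * \<eta>)" using \<eta>(1) \<open>0 \<le> K\<close> by simp
    then have "0 \<le> 2 * (r / t) * (\<eta> * (1 + 8 * K * \<eta>))" using r t by simp
    then have "0 \<le> \<delta>" using \<eta>(2) by linarith
    moreover from False have "E i s = {}" if "t < s" "s < t + \<kappa>" for s using that by blast
    ultimately show ?thesis by (simp add: hausdorff_gauge_def)
  qed
  then obtain s0 where s0: "\<And>i s. t < s \<Longrightarrow> s < t + \<kappa> \<Longrightarrow> bounded (E i s) \<and> diameter (E i s) \<le> \<delta> \<and>
     hausdorff_gauge n (E i s) \<le> ennreal ((r / t) ^ n) * ennreal (slice_vol n (\<rho>' i) (s - s0 i))" by metis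
  \<comment> \<open>The gauges of the cuts need not be measurable in \<open>s\<close>; the slice
    volumes that bound them are, and their integrals are known.\<close>
  define g where "g s = (\<Sum>i. ennreal (slice_vol n (\<rho>' i) (s - s0 i)))" for s
  \<comment> \<open>The power comes from
    \<open>\<rho>' i \<le> \<rho> i * (1 + 8 * K * \<eta>)\<close> in dimension
    \<open>Suc n\<close>, and \<open>\<tau> + \<eta>\<close> bounds the total volume of the
    balls.\<close>
  define M where "M = (1 + 8 * K * \<eta>) ^ Suc n * (\<tau> + \<eta>)"
  have M: "0 \<le> M" "M < M + \<eta>" using \<open>0 \<le> K\<close> \<eta>(1) \<tau>(2) by (auto simp: M_def)
  have gm: "g \<in> borel_measurable borel" unfolding g_def by measurable
  have "(\<integral>\<^sup>+ s. g s \<partial>lborel) = (\<Sum>i. (\<integral>\<^sup>+ s. ennreal (slice_vol n (\<rho>' i) (s - s0 i)) \<partial>lborel))"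
    unfolding g_def by (intro nn_integral_suminf) measurable
  also have "\<dots> \<le> (\<Sum>i. ennreal ((1 + 8 * K * \<eta>) ^ Suc n) * emeasure lborel (cball (c i) (\<rho> i)))"
  proof (intro suminf_le)
    fix i
    have "\<rho>' i ^ Suc n \<le> (\<rho> i * (1 + 8 * K * \<eta>)) ^ Suc n" using \<rho>' by (intro power_mono) auto
    then have "unit_ball_vol (Suc n) * \<rho>' i ^ Suc n \<le> unit_ball_vol (Suc n) * (\<rho> i * (1 + 8 * K * \<eta>)) ^ Suc n"
      by (intro mult_left_mono) auto
    also have "\<dots> = (1 + 8 * K * \<eta>) ^ Suc n * (unit_ball_vol (Suc n) * \<rho> i ^ Suc n)"
      by (simp add: power_mult_distrib mult_ac)
    finally have "ennreal (unit_ball_vol (Suc n) * \<rho>' i ^ Suc n) \<le> ennreal ((1 + 8 * K * \<eta>) ^ Suc n * (unit_ball_vol (Suc n) * \<rho> i ^ Suc n))"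
      by (rule ennreal_leI)
    also have "\<dots> = ennreal ((1 + 8 * K * \<eta>) ^ Suc n) * emeasure lborel (cball (c i) (\<rho> i))"
      unfolding emeasure_cball[OF c(1)] Sn using \<open>0 \<le> K\<close> \<eta>(1) by (intro ennreal_mult') auto
    finally show "(\<integral>\<^sup>+ s. ennreal (slice_vol n (\<rho>' i) (s - s0 i)) \<partial>lborel) \<le> ennreal ((1 + 8 * K * \<eta>) ^ Suc n) * emeasure lborel (cball (c i) (\<rho> i))"
      by (simp only: nn_integral_slice_vol[OF \<rho>'(1)])
  qed auto
  also have "\<dots> = ennreal ((1 + 8 * K * \<eta>) ^ Suc n) * (\<Sum>i. emeasure lborel (cball (c i) (\<rho> i)))" by simp
  also have "\<dots> \<le> ennreal ((1 + 8 * K * \<eta>) ^ Suc n) * (emeasure lborel T + ennreal \<eta>)" using c(4) by (intro mult_left_mono) auto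
  also have "\<dots> = ennreal M"
    unfolding T_def \<tau>(1) M_def using \<tau>(2) \<eta>(1) \<open>0 \<le> K\<close> by (simp add: ennreal_mult[symmetric] ennreal_plus[symmetric] del: ennreal_plus)
  finally have gM: "(\<integral>\<^sup>+ s. g s \<partial>lborel) \<le> ennreal M" .
  have "t < t + \<kappa>" using t by simp
  then obtain s where s: "t < s" "s < t + \<kappa>" "g s \<le> ennreal ((M + \<eta>) / ((t + \<kappa>) - t))"
    by (rule exists_le_average[OF gm gM M]) (rule that)
  have "hausdorff_premeasure n \<delta> Z \<le> (\<Sum>i. hausdorff_gauge n (E i s))"
  proof (rule hausdorff_premeasure_le)
    show "Z \<subseteq> (\<Union>i. E i s)"
    proof
      fix z assume z: "z \<in> Z"
      then have "?d (X s z) = s" using s t by (intro dX) auto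
      then have "X s z \<in> T" using s by (simp add: T_def)
      then obtain i where "X s z \<in> cball (c i) (\<rho> i)" using c(3) by blast
      then show "z \<in> (\<Union>i. E i s)" using z by (auto simp: E_def)
    qed
  qed (use s0 s in auto)
  also have "\<dots> \<le> (\<Sum>i. ennreal ((r / t) ^ n) * ennreal (slice_vol n (\<rho>' i) (s - s0 i)))"
    using s0 s by (intro suminf_le) auto
  also have "\<dots> = ennreal ((r / t) ^ n) * g s" by (simp add: g_def)
  also have "\<dots> \<le> ennreal ((r / t) ^ n) * ennreal ((M + \<eta>) / \<kappa>)" using s by (intro mult_left_mono) auto
  also have "\<dots> = ennreal ((r / t) ^ n * ((M + \<eta>) / \<kappa>))" using r t by (intro ennreal_mult'[symmetric]) auto
  finally show ?thesis by (simp add: Z_def M_def)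
qed

text \<open>\<open>K\<close> depends only on \<open>t\<close>, \<open>\<kappa>\<close> and
  \<open>r\<close>, so all error terms disappear when, for each fixed \<open>\<delta>\<close>, the
  bound \<open>\<eta>\<close> on the radii of the covering balls tends to 0.\<close>

lemma hausdorff_level_set_le:
  fixes A :: "'a::euclidean_space set"
  assumes A: "closed A" "A \<noteq> {}" and t: "0 < t" "0 < \<kappa>" "t + \<kappa> < r"
    and \<tau>: "emeasure lborel {x. t < infdist x A \<and> infdist x A < t + \<kappa>} = ennreal \<tau>" "0 \<le> \<tau>"
  defines "n \<equiv> DIM('a) - 1"
  shows "hausdorff_measure n {x. infdist x A = r} \<le> ennreal ((r / t) ^ n * (\<tau> / \<kappa>))"
proof (rule hausdorff_measure_leI)
  fix \<delta> :: real assume "\<delta> > 0"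
  define K where "K = max (1 / (2 * t)) (1 / (2 * (r - (t + \<kappa>))))"
  let ?u = "\<lambda>\<eta>. ennreal ((r / t) ^ n * (((1 + 8 * K * \<eta>) ^ Suc n * (\<tau> + \<eta>) + \<eta>) / \<kappa>))"
  have "((\<lambda>\<eta>. 2 * (r / t) * (\<eta> * (1 + 8 * K * \<eta>))) \<longlongrightarrow> 2 * (r / t) * (0 * (1 + 8 * K * 0))) (at_right 0)"
    by (intro tendsto_intros)
  then have "\<forall>\<^sub>F \<eta> in at_right 0. 2 * (r / t) * (\<eta> * (1 + 8 * K * \<eta>)) < \<delta>"
    by (rule order_tendstoD) (use \<open>\<delta> > 0\<close> in simp)
  moreover have "\<forall>\<^sub>F \<eta>::real in at_right 0. 0 < \<eta>" by (rule eventually_at_right_less)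
  ultimately have ev: "\<forall>\<^sub>F \<eta> in at_right 0. hausdorff_premeasure n \<delta> {x. infdist x A = r} \<le> ?u \<eta>"
  proof eventually_elim
    case (elim \<eta>)
    then show ?case unfolding n_def
      by (intro hausdorff_level_set_cover[OF A t _ _ \<tau>]) (auto simp: K_def)
  qed
  have "(?u \<longlongrightarrow> ennreal ((r / t) ^ n * (((1 + 8 * K * 0) ^ Suc n * (\<tau> + 0) + 0) / \<kappa>))) (at_right 0)"
    by (intro tendsto_ennrealI tendsto_intros) (use t in auto)
  then have "(?u \<longlongrightarrow> ennreal ((r / t) ^ n * (\<tau> / \<kappa>))) (at_right 0)" by simp
  then show "hausdorff_premeasure n \<delta> {x. infdist x A = r} \<le> ennreal ((r / t) ^ n * (\<tau> / \<kappa>))"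
    by (rule tendsto_lowerbound[OF _ ev]) simp
qed

section \<open>The right derivative of the volume is bounded by surface area\<close>

text \<open>
  Each set of a fine cover of the frontier spans a tube of segments reaching the layer. Since the
  frontier points involved have tangent balls on both sides, the segments of a tube are nearly
  parallel, and the part of the tube in the thin layer fits into a cylinder.
\<close>

lemma emeasure_layer_le:
  fixes A :: "'a::euclidean_space set"
  assumes A: "closed A" "A \<noteq> {}" and r: "0 < r" "r < R1" "R1 < R2"
    and K: "1 / (2 * r) \<le> K" "1 / (2 * (R1 - r)) \<le> K"
    and H: "hausdorff_measure (real (DIM('a) - 1)) (frontier {x. infdist x A \<le> r}) = ennreal H" "0 \<le> H"
  defines "n \<equiv> DIM('a) - 1"
  shows "emeasure lborel {x. R1 < infdist x A \<and> infdist x A \<le> R2} \<le> ennreal ((R2 - R1) * (R2 / r + 6 * K * (R2 - R1)) ^ n * H)"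
proof -
  let ?d = "\<lambda>x. infdist x A"
  let ?G = "frontier {x. infdist x A \<le> r}"
  define T where "T = {x. R1 < ?d x \<and> ?d x \<le> R2}"
  \<comment> \<open>\<open>L\<close> bounds the width of a tube per unit of diameter of its base:
    \<open>R2 / r\<close> from the expansion along segments, \<open>6 * K * \<kappa>\<close> from
    their tilt across the layer. \<open>B\<close> collects the height errors per
    \<open>\<eta>\<close>: 1 at the top, and 1 plus the tilt loss \<open>(R2 - r) * (6 * K)\<close>
    at the bottom.\<close>
  define \<kappa> L B where "\<kappa> = R2 - R1" and "L = R2 / r + 6 * K * \<kappa>" and "B = (R2 - r) * (6 * K) + 2"
  have "0 < 1 / (2 * r)" using r by simp
  then have "0 \<le> K" using K by linarith
  have L0: "0 \<le> L" using r \<open>0 \<le> K\<close> by (simp add: L_def \<kappa>_def)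
  have B0: "0 \<le> B" using r \<open>0 \<le> K\<close> by (simp add: B_def)
  have \<kappa>: "0 < \<kappa>" using r by (simp add: \<kappa>_def)
  have "\<exists>a\<in>A. ?d z = dist z a" for z using infdist_attains_inf[OF A, of z] by metis
  then obtain p where p: "\<And>z. p z \<in> A" "\<And>z. ?d z = dist z (p z)" by metis
  define \<nu> where "\<nu> x = (x - p x) /\<^sub>R ?d x" for x
  define Y where "Y x = p x + r *\<^sub>R \<nu> x" for x
  have pos: "0 < ?d x" if "x \<in> T" for x using that r by (simp add: T_def)
  have \<nu>: "norm (\<nu> x) = 1" and px: "p x + ?d x *\<^sub>R \<nu> x = x" if "x \<in> T" for x
    using pos[OF that] p(2)[of x] by (auto simp: \<nu>_def dist_norm)
  have dseg: "?d (p x + s *\<^sub>R \<nu> x) = s" if "x \<in> T" "0 \<le> s" "s \<le> ?d x" for x s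
    using that px[OF that(1)] by (intro infdist_on_segment[OF p(1)[of x] \<nu>[OF that(1)], of "?d x" s]) auto
  \<comment> \<open>Each segment is used only up to level \<open>R1\<close>, so the outer tangent
    ball has radius \<open>R1 - r\<close> for every \<open>x\<close> and \<open>K\<close> is
    uniform.\<close>
  have q: "quadratic_tangent ?d K (Y x) (\<nu> x)" if "x \<in> T" for x
    unfolding Y_def using that r dseg[OF that, of R1]
    by (intro infdist_quadratic_tangent[OF p(1)[of x] \<nu>[OF that], of R1] K) (auto simp: T_def)
  \<comment> \<open>The level set at \<open>r\<close> can contain interior points of the parallel
    set, such as local maxima of the distance. A base point \<open>Y x\<close> is not of this kind,
    since the distance keeps growing along its segment.\<close>
  have Yfr: "Y x \<in> ?G" if x: "x \<in> T" for x
  proof -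
    have "?d (Y x) = r" unfolding Y_def using x r by (intro dseg) (auto simp: T_def)
    moreover have "Y x \<notin> interior {x. ?d x \<le> r}"
    proof
      assume "Y x \<in> interior {x. ?d x \<le> r}"
      then obtain e where e: "e > 0" "ball (Y x) e \<subseteq> {x. ?d x \<le> r}" by (meson mem_interior)
      define s where "s = r + min (e / 2) (R1 - r)"
      have s: "r < s" "s \<le> R1" "s < r + e" using e r by (auto simp: s_def)
      have "dist (Y x) (p x + s *\<^sub>R \<nu> x) = norm ((r - s) *\<^sub>R \<nu> x)" by (simp add: Y_def dist_norm scaleR_diff_left)
      then have "p x + s *\<^sub>R \<nu> x \<in> ball (Y x) e" using s \<nu>[OF x] by simp
      then have "?d (p x + s *\<^sub>R \<nu> x) \<le> r" using e by blast
      moreover have "?d (p x + s *\<^sub>R \<nu> x) = s" using x s r by (intro dseg) (auto simp: T_def)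
      ultimately show False using s by simp
    qed
    ultimately show ?thesis by (simp add: frontier_def closure_subset[THEN subsetD])
  qed
  have bound: "emeasure lborel T \<le> ennreal ((\<kappa> + B * \<eta>) * L ^ n * (H + \<eta>))" if "0 < \<eta>" for \<eta>
  proof -
    have "hausdorff_measure (real n) ?G < ennreal (H + \<eta>)" using H \<open>0 < \<eta>\<close> by (simp add: n_def ennreal_less_iff)
    from this \<open>0 < \<eta>\<close> obtain E where E: "?G \<subseteq> (\<Union>i::nat. E i)" "\<And>i. bounded (E i)" "\<And>i. diameter (E i) \<le> \<eta>"
      "(\<Sum>i. hausdorff_gauge n (E i)) < ennreal (H + \<eta>)" by (rule hausdorff_cover_exists) (rule that)
    define F where "F i = {x \<in> T. Y x \<in> E i}" for i
    have B\<eta>: "0 \<le> \<kappa> + B * \<eta>" using \<kappa> B0 \<open>0 < \<eta>\<close> by simp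
    have Fi: "emeasure lborel (closure (F i)) \<le> ennreal ((\<kappa> + B * \<eta>) * L ^ n) * hausdorff_gauge n (E i)" for i
    proof (cases "F i = {}")
      case False
      then obtain x0 where x0: "x0 \<in> T" "Y x0 \<in> E i" by (auto simp: F_def)
      define u D where "u = \<nu> x0" and "D = L * diameter (E i)"
      have u: "norm u = 1" using \<nu>[OF x0(1)] by (simp add: u_def)
      have dE0: "0 \<le> diameter (E i)" using E(2) by (rule diameter_ge_0)
      have D0: "0 \<le> D" using L0 dE0 by (simp add: D_def)
      have YE: "norm (Y x - Y x') \<le> diameter (E i)" if "x \<in> F i" "x' \<in> F i" for x x'
        using diameter_bounded_bound[OF E(2), of "Y x" i "Y x'"] that by (simp add: F_def dist_norm)
      have \<nu>E: "norm (\<nu> x - u) \<le> 6 * K * diameter (E i)" if x: "x \<in> F i" for x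
      proof -
        have xT: "x \<in> T" using x by (simp add: F_def)
        have "norm (\<nu> x - u) \<le> 6 * K * norm (Y x - Y x0)"
          unfolding u_def by (rule quadratic_tangent_lipschitz[OF q[OF x0(1)] q[OF xT] \<open>0 \<le> K\<close>])
        also have "\<dots> \<le> 6 * K * diameter (E i)" using YE[OF x, of x0] x0 \<open>0 \<le> K\<close> by (intro mult_left_mono) (auto simp: F_def)
        finally show ?thesis .
      qed
      have xY: "x = Y x + (?d x - r) *\<^sub>R \<nu> x" if "x \<in> T" for x
        using px[OF that] by (simp add: Y_def algebra_simps)
      have width: "norm (perp u (x - x')) \<le> D" if x: "x \<in> F i" "x' \<in> F i" "?d x \<le> ?d x'" for x x'
      proof -
        have xT: "x \<in> T" "x' \<in> T" using x by (auto simp: F_def)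
        \<comment> \<open>\<open>x''\<close> is the point at the level of \<open>x\<close> on the
          segment of \<open>x'\<close>. At equal levels the expansion bound applies; the remaining
          piece runs along \<open>\<nu> x'\<close>, which is nearly parallel to \<open>u\<close>,
          and adds little orthogonally to \<open>u\<close>.\<close>
        define s x'' where "s = ?d x" and "x'' = p x' + s *\<^sub>R \<nu> x'"
        have s: "R1 < s" "s \<le> ?d x'" "?d x' \<le> R2" using xT x by (auto simp: s_def T_def)
        have "?d x'' = s" unfolding x''_def using xT s r by (intro dseg) auto
        then have "r / s * norm (x - x'') \<le> norm (Y x - Y x')"
          using infdist_segment_contraction[OF p(1)[of x] \<nu>[OF xT(1)] _ p(1)[of x'] \<nu>[OF xT(2)], of s r] s r px[OF xT(1)]
          by (simp add: Y_def x''_def s_def)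
        then have "norm (x - x'') \<le> s / r * norm (Y x - Y x')" using s r by (simp add: field_simps)
        also have "\<dots> \<le> R2 / r * diameter (E i)" using YE[OF x(1,2)] s r by (intro mult_mono divide_right_mono) auto
        finally have 1: "norm (x - x'') \<le> R2 / r * diameter (E i)" .
        have "norm (perp u ((?d x' - s) *\<^sub>R \<nu> x')) = (?d x' - s) * norm (perp u (\<nu> x'))" using s by (simp add: perp_scaleR)
        also have "\<dots> \<le> \<kappa> * (6 * K * diameter (E i))"
          using s norm_perp_unit_le[OF u, of "\<nu> x'"] \<nu>E[OF x(2)] by (intro mult_mono) (auto simp: \<kappa>_def)
        finally have 2: "norm (perp u ((?d x' - s) *\<^sub>R \<nu> x')) \<le> \<kappa> * (6 * K * diameter (E i))" .
        have "x - x' = (x - x'') - (?d x' - s) *\<^sub>R \<nu> x'"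
          using px[OF xT(2)] by (simp add: x''_def algebra_simps)
        then have "norm (perp u (x - x')) \<le> norm (perp u (x - x'')) + norm (perp u ((?d x' - s) *\<^sub>R \<nu> x'))"
          by (simp only: perp_diff[of u "x - x''"] norm_triangle_ineq4)
        also have "\<dots> \<le> R2 / r * diameter (E i) + \<kappa> * (6 * K * diameter (E i))"
          using norm_perp_le[OF u, of "x - x''"] 1 2 by linarith
        finally show ?thesis by (simp add: D_def L_def algebra_simps)
      qed
      have width': "(norm (x - x'))\<^sup>2 - ((x - x') \<bullet> u)\<^sup>2 \<le> D\<^sup>2" if x: "x \<in> F i" "x' \<in> F i" for x x'
      proof -
        have "norm (perp u (x - x')) \<le> D"
        proof (cases "?d x \<le> ?d x'")
          case False
          then have "norm (perp u (x' - x)) \<le> D" using width x by simp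
          then show ?thesis by (simp add: perp_diff norm_minus_commute)
        qed (use width x in simp)
        then have "(norm (perp u (x - x')))\<^sup>2 \<le> D\<^sup>2" by (intro power_mono) auto
        then show ?thesis by (simp add: norm_perp_sq[OF u])
      qed
      define \<alpha> \<beta> where "\<alpha> = Y x0 \<bullet> u + (R1 - r) - ((R2 - r) * (6 * K) + 1) * \<eta>" and "\<beta> = Y x0 \<bullet> u + (R2 - r) + \<eta>"
      have \<alpha>\<beta>: "\<beta> - \<alpha> = \<kappa> + B * \<eta>" by (simp add: \<alpha>_def \<beta>_def \<kappa>_def B_def algebra_simps)
      have height: "\<alpha> \<le> x \<bullet> u \<and> x \<bullet> u \<le> \<beta>" if x: "x \<in> F i" for x
      proof -
        have xT: "x \<in> T" using x by (simp add: F_def)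
        then have dx: "R1 < ?d x" "?d x \<le> R2" by (auto simp: T_def)
        have "\<bar>(Y x - Y x0) \<bullet> u\<bar> \<le> norm (Y x - Y x0) * norm u" by (rule Cauchy_Schwarz_ineq2)
        also have "\<dots> \<le> \<eta>" using YE[OF x, of x0] x0 E(3)[of i] u by (simp add: F_def)
        finally have 1: "\<bar>(Y x - Y x0) \<bullet> u\<bar> \<le> \<eta>" .
        have "\<bar>(\<nu> x - u) \<bullet> u\<bar> \<le> norm (\<nu> x - u) * norm u" by (rule Cauchy_Schwarz_ineq2)
        also have "\<dots> \<le> 6 * K * diameter (E i)" using \<nu>E[OF x] u by simp
        also have "\<dots> \<le> 6 * K * \<eta>" using E(3)[of i] \<open>0 \<le> K\<close> by (intro mult_left_mono) auto
        finally have "1 - 6 * K * \<eta> \<le> \<nu> x \<bullet> u" using u by (simp add: inner_diff_left norm_eq_1)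
        then have "(?d x - r) * (1 - 6 * K * \<eta>) \<le> (?d x - r) * (\<nu> x \<bullet> u)" using dx r by (intro mult_left_mono) auto
        moreover have "(?d x - r) * (6 * K * \<eta>) \<le> (R2 - r) * (6 * K * \<eta>)"
          using dx r \<open>0 \<le> K\<close> \<open>0 < \<eta>\<close> by (intro mult_right_mono) auto
        ultimately have 2: "(?d x - r) - (R2 - r) * (6 * K * \<eta>) \<le> (?d x - r) * (\<nu> x \<bullet> u)" by (simp add: right_diff_distrib)
        have "\<nu> x \<bullet> u \<le> norm (\<nu> x) * norm u" by (rule norm_cauchy_schwarz)
        then have "\<nu> x \<bullet> u \<le> 1" using u \<nu>[OF xT] by simp
        then have "(?d x - r) * (\<nu> x \<bullet> u) \<le> (?d x - r) * 1" using dx r by (intro mult_left_mono) auto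
        then have 3: "(?d x - r) * (\<nu> x \<bullet> u) \<le> R2 - r" using dx by simp
        have "x \<bullet> u = Y x0 \<bullet> u + (Y x - Y x0) \<bullet> u + (?d x - r) * (\<nu> x \<bullet> u)"
          using arg_cong[OF xY[OF xT], of "\<lambda>x. x \<bullet> u"] by (simp add: inner_add_left inner_diff_left)
        then show ?thesis using 1 2 3 dx by (simp add: \<alpha>_def \<beta>_def algebra_simps abs_le_iff)
      qed
      have "emeasure lborel (closure (F i)) \<le> ennreal ((\<beta> - \<alpha>) * (unit_ball_vol (real n) * (D / 2) ^ n))"
        unfolding n_def using \<alpha>\<beta> B\<eta> by (intro emeasure_cylinder[OF u D0 width' height]) auto
      also have "(\<beta> - \<alpha>) * (unit_ball_vol (real n) * (D / 2) ^ n) = (\<kappa> + B * \<eta>) * L ^ n * (unit_ball_vol n * (diameter (E i) / 2) ^ n)"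
        unfolding \<alpha>\<beta> by (simp add: D_def power_mult_distrib power_divide)
      also have "ennreal \<dots> = ennreal ((\<kappa> + B * \<eta>) * L ^ n) * hausdorff_gauge n (E i)"
        using x0 B\<eta> L0 by (auto simp: hausdorff_gauge_nat[OF E(2)] intro!: ennreal_mult')
      finally show ?thesis .
    qed simp
    have "T \<subseteq> (\<Union>i. closure (F i))"
    proof
      fix x assume "x \<in> T"
      then obtain i where "Y x \<in> E i" using Yfr[of x] E(1) by blast
      then have "x \<in> F i" using \<open>x \<in> T\<close> by (simp add: F_def)
      then show "x \<in> (\<Union>i. closure (F i))" using closure_subset[of "F i"] by blast
    qed
    then have "emeasure lborel T \<le> emeasure lborel (\<Union>i. closure (F i))"
      by (rule emeasure_mono) (auto intro!: sets.countable_UN')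
    also have "\<dots> \<le> (\<Sum>i. emeasure lborel (closure (F i)))" by (intro emeasure_subadditive_countably) auto
    also have "\<dots> \<le> (\<Sum>i. ennreal ((\<kappa> + B * \<eta>) * L ^ n) * hausdorff_gauge n (E i))"
      using Fi by (intro suminf_le) auto
    also have "\<dots> = ennreal ((\<kappa> + B * \<eta>) * L ^ n) * (\<Sum>i. hausdorff_gauge n (E i))" by simp
    also have "\<dots> \<le> ennreal ((\<kappa> + B * \<eta>) * L ^ n) * ennreal (H + \<eta>)" using E(4) by (intro mult_left_mono) auto
    also have "\<dots> = ennreal ((\<kappa> + B * \<eta>) * L ^ n * (H + \<eta>))"
      using B\<eta> L0 by (intro ennreal_mult'[symmetric]) auto
    finally show ?thesis .
  qed
  let ?u = "\<lambda>\<eta>. ennreal ((\<kappa> + B * \<eta>) * L ^ n * (H + \<eta>))"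
  have "(?u \<longlongrightarrow> ennreal ((\<kappa> + B * 0) * L ^ n * (H + 0))) (at_right 0)"
    by (intro tendsto_ennrealI tendsto_intros)
  moreover have "\<forall>\<^sub>F \<eta> in at_right 0. emeasure lborel T \<le> ?u \<eta>"
    using eventually_at_right_less[of 0] by eventually_elim (rule bound)
  ultimately have "emeasure lborel T \<le> ennreal ((\<kappa> + B * 0) * L ^ n * (H + 0))"
    by (rule tendsto_lowerbound) simp
  then show ?thesis by (simp add: T_def \<kappa>_def L_def)
qed

section \<open>Volume and surface area of parallel sets\<close>

lemma infdist_closure_eq: "infdist x (closure A) = infdist x (A :: 'a::euclidean_space set)"
proof (cases "A = {}")
  case False
  then obtain a where a: "a \<in> closure A" "infdist x (closure A) = dist x a"
    using infdist_attains_inf[of "closure A" x] by auto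
  have "infdist a A = 0" using a False in_closure_iff_infdist_zero by blast
  then have "infdist x A \<le> infdist x (closure A)" using infdist_triangle[of x A a] a by simp
  moreover have "infdist x (closure A) \<le> infdist x A" using False closure_subset by (intro infdist_mono) auto
  ultimately show ?thesis by simp
qed simp

lemma parallel_set_eq: "A \<noteq> {} \<Longrightarrow> parallel_set A r = {x. infdist x (closure A) \<le> r}" for A :: "'a::euclidean_space set"
  by (simp add: parallel_set_def infdist_closure_eq)

lemma parallel_set_empty: "parallel_set {} r = {}"
  by (simp add: parallel_set_def)

lemma compact_parallel_set:
  fixes A :: "'a::euclidean_space set"
  assumes "bounded A"
  shows "compact (parallel_set A r)"
proof (cases "A = {}")
  case False
  obtain b where b: "\<And>a. a \<in> closure A \<Longrightarrow> norm a \<le> b" using bounded_closure[OF assms] by (auto simp: bounded_iff)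
  have "norm x \<le> b + r" if "x \<in> parallel_set A r" for x
  proof -
    obtain a where a: "a \<in> closure A" "infdist x (closure A) = dist x a"
      using infdist_attains_inf[of "closure A" x] False by auto
    then show ?thesis using that b[OF a(1)] False norm_triangle_ineq2[of x a] by (simp add: parallel_set_eq dist_norm)
  qed
  then have "bounded (parallel_set A r)" by (auto simp: bounded_iff)
  moreover have "closed (parallel_set A r)" unfolding parallel_set_eq[OF False]
    by (intro closed_Collect_le continuous_intros)
  ultimately show ?thesis by (simp add: compact_eq_bounded_closed)
qed (simp add: parallel_set_empty)

definition volume_fn :: "'a::euclidean_space set \<Rightarrow> real \<Rightarrow> real" where
  "volume_fn A r = measure lborel (parallel_set A r)"

lemma emeasure_parallel_set:
  assumes "bounded A"
  shows "emeasure lborel (parallel_set A r) = ennreal (volume_fn A r)"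
  unfolding volume_fn_def using emeasure_compact_finite[OF compact_parallel_set[OF assms], of r]
  by (intro emeasure_eq_ennreal_measure) auto

lemma parallel_volume_eq:
  assumes "bounded A"
  shows "parallel_volume A r = ennreal (volume_fn A r)"
  unfolding parallel_volume_def using compact_parallel_set[OF assms, of r]
  by (simp add: hausdorff_measure_eq_lborel emeasure_parallel_set[OF assms] borel_compact)

lemma volume_fn_nonneg: "0 \<le> volume_fn A r"
  by (simp add: volume_fn_def)

lemma parallel_set_mono: "s \<le> r \<Longrightarrow> parallel_set A s \<subseteq> parallel_set A r"
  by (auto simp: parallel_set_def)

lemma emeasure_parallel_annulus:
  assumes "bounded A" "s \<le> r"
  shows "emeasure lborel (parallel_set A r - parallel_set A s) = ennreal (volume_fn A r - volume_fn A s)"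
  using emeasure_Diff[of lborel "parallel_set A s" "parallel_set A r"] parallel_set_mono[OF assms(2), of A]
    borel_compact[OF compact_parallel_set[OF assms(1)]]
  by (simp add: emeasure_parallel_set[OF assms(1)] ennreal_minus volume_fn_nonneg)

lemma volume_fn_mono:
  assumes "bounded A" "s \<le> r"
  shows "volume_fn A s \<le> volume_fn A r"
proof -
  have "emeasure lborel (parallel_set A s) \<le> emeasure lborel (parallel_set A r)"
    using parallel_set_mono[OF assms(2)] borel_compact[OF compact_parallel_set[OF assms(1)]] by (intro emeasure_mono) auto
  then show ?thesis by (simp add: emeasure_parallel_set[OF assms(1)] volume_fn_nonneg)
qed

text \<open>The levels averaged over must stay below \<open>r\<close>, but the resulting bound no
  longer contains \<open>K\<close>; so their thickness \<open>\<kappa>\<close> may afterwards tend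
  to \<open>r - t\<close>.\<close>

lemma parallel_surface_le_difference_quotient:
  fixes A :: "'a::euclidean_space set"
  assumes A: "bounded A" and t: "0 < t" "t < r"
  shows "parallel_surface A r \<le> ennreal ((r / t) ^ (DIM('a) - 1) * ((volume_fn A r - volume_fn A t) / (r - t)))"
proof (cases "A = {}")
  case False
  let ?n = "DIM('a) - 1" and ?v = "volume_fn A"
  let ?d = "\<lambda>x. infdist x (closure A)"
  have "frontier (parallel_set A r) \<subseteq> {x. ?d x = r}"
  proof
    fix x assume x: "x \<in> frontier (parallel_set A r)"
    have "closed (parallel_set A r)" using compact_parallel_set[OF A] by (rule compact_imp_closed)
    then have "x \<in> parallel_set A r" using x frontier_subset_closed by blast
    then have "?d x \<le> r" by (simp add: parallel_set_eq[OF False])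
    moreover have "\<not> ?d x < r"
    proof
      assume "?d x < r"
      moreover have "open {x. ?d x < r}" by (intro open_Collect_less continuous_intros)
      moreover have "{x. ?d x < r} \<subseteq> parallel_set A r" by (auto simp: parallel_set_eq[OF False])
      ultimately have "x \<in> interior (parallel_set A r)" by (intro interiorI[of "{x. ?d x < r}"]) auto
      then show False using x by (simp add: frontier_def)
    qed
    ultimately show "x \<in> {x. ?d x = r}" by simp
  qed
  then have S: "parallel_surface A r \<le> hausdorff_measure ?n {x. ?d x = r}"
    unfolding parallel_surface_def by (rule hausdorff_measure_mono)
  have bound: "parallel_surface A r \<le> ennreal ((r / t) ^ ?n * ((?v r - ?v t) / \<kappa>))" if \<kappa>: "0 < \<kappa>" "\<kappa> < r - t" for \<kappa>
  proof -
    define T where "T = {x. t < ?d x \<and> ?d x < t + \<kappa>}"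
    have "T \<subseteq> parallel_set A r - parallel_set A t" using \<kappa> by (auto simp: T_def parallel_set_eq[OF False])
    then have "emeasure lborel T \<le> emeasure lborel (parallel_set A r - parallel_set A t)"
      using borel_compact[OF compact_parallel_set[OF A]] by (intro emeasure_mono) auto
    also have "\<dots> = ennreal (?v r - ?v t)" using t by (intro emeasure_parallel_annulus[OF A]) simp
    finally have le: "emeasure lborel T \<le> ennreal (?v r - ?v t)" .
    define \<tau> where "\<tau> = measure lborel T"
    have fin: "emeasure lborel T = ennreal \<tau>" unfolding \<tau>_def using le
      by (intro emeasure_eq_ennreal_measure) (auto simp: top_unique)
    have \<tau>: "0 \<le> \<tau>" by (simp add: \<tau>_def)
    have \<tau>': "\<tau> \<le> ?v r - ?v t" using le fin volume_fn_mono[OF A, of t r] t by simp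
    note S
    also have "hausdorff_measure ?n {x. ?d x = r} \<le> ennreal ((r / t) ^ ?n * (\<tau> / \<kappa>))"
      using hausdorff_level_set_le[OF closed_closure _ t(1) \<kappa>(1) _ fin[unfolded T_def] \<tau>, of r] False \<kappa> by simp
    also have "\<dots> \<le> ennreal ((r / t) ^ ?n * ((?v r - ?v t) / \<kappa>))"
      using \<tau>' \<kappa> t by (intro ennreal_leI mult_left_mono divide_right_mono) auto
    finally show ?thesis .
  qed
  have "((\<lambda>\<kappa>. ennreal ((r / t) ^ ?n * ((?v r - ?v t) / \<kappa>))) \<longlongrightarrow> ennreal ((r / t) ^ ?n * ((?v r - ?v t) / (r - t)))) (at_left (r - t))"
    by (intro tendsto_ennrealI tendsto_intros) (use t in auto)
  moreover have "\<forall>\<^sub>F \<kappa> in at_left (r - t). parallel_surface A r \<le> ennreal ((r / t) ^ ?n * ((?v r - ?v t) / \<kappa>))"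
  proof -
    have "\<forall>\<^sub>F \<kappa> in at_left (r - t). \<kappa> \<in> {0<..<r - t}" using t by (intro eventually_at_left_real) simp
    then show ?thesis by eventually_elim (rule bound, simp_all)
  qed
  ultimately show ?thesis by (rule tendsto_lowerbound) simp
qed (simp add: parallel_surface_def parallel_set_empty)

text \<open>\<open>enn2real\<close> would turn an infinite area into 0; for bounded \<open>A\<close>
  and positive \<open>r\<close> the area is finite, by comparison with the volume between the levels
  \<open>r / 2\<close> and \<open>r\<close>.\<close>

definition surface_fn :: "'a::euclidean_space set \<Rightarrow> real \<Rightarrow> real" where
  "surface_fn A r = enn2real (parallel_surface A r)"

lemma surface_fn_nonneg: "0 \<le> surface_fn A r"
  by (simp add: surface_fn_def)

lemma parallel_surface_eq:
  assumes "bounded A" "0 < r"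
  shows "parallel_surface A r = ennreal (surface_fn A r)"
proof -
  have "parallel_surface A r < top"
    using parallel_surface_le_difference_quotient[OF assms(1), of "r / 2" r] assms(2) by (auto intro: order_le_less_trans)
  then show ?thesis by (simp add: surface_fn_def)
qed

lemma surface_fn_le_difference_quotient:
  fixes A :: "'a::euclidean_space set"
  assumes A: "bounded A" and t: "0 < t" "t < r"
  shows "(t / r) ^ (DIM('a) - 1) * surface_fn A r \<le> (volume_fn A r - volume_fn A t) / (r - t)"
proof -
  let ?q = "(volume_fn A r - volume_fn A t) / (r - t)"
  have "0 \<le> ?q" using volume_fn_mono[OF A, of t r] t by simp
  then have "0 \<le> (r / t) ^ (DIM('a) - 1) * ?q" using t by (intro mult_nonneg_nonneg) auto
  moreover have "ennreal (surface_fn A r) \<le> ennreal ((r / t) ^ (DIM('a) - 1) * ?q)"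
    unfolding parallel_surface_eq[OF A less_trans[OF t], symmetric] by (rule parallel_surface_le_difference_quotient[OF A t])
  ultimately have "surface_fn A r \<le> (r / t) ^ (DIM('a) - 1) * ?q" by (simp only: ennreal_le_iff)
  then have "(t / r) ^ (DIM('a) - 1) * surface_fn A r \<le> (t / r) ^ (DIM('a) - 1) * ((r / t) ^ (DIM('a) - 1) * ?q)"
    using t by (intro mult_left_mono) auto
  also have "\<dots> = ((t / r) * (r / t)) ^ (DIM('a) - 1) * ?q" by (simp only: power_mult_distrib mult.assoc)
  also have "\<dots> = ?q" using t by simp
  finally show ?thesis .
qed

text \<open>The tilt error of one layer is proportional to its thickness. \<open>K\<close> depends
  only on \<open>r\<close> and on the gap \<open>s - r\<close>, so cutting the range from
  \<open>s\<close> to \<open>R\<close> into \<open>Suc N\<close> equal layers keeps \<open>K\<close>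
  fixed; the layer bounds add up, and the error vanishes as \<open>N\<close> grows.\<close>

lemma volume_fn_diff_le:
  fixes A :: "'a::euclidean_space set"
  assumes A: "bounded A" and r: "0 < r" "r < s" "s < R"
  shows "volume_fn A R - volume_fn A s \<le> (R - s) * (R / r) ^ (DIM('a) - 1) * surface_fn A r"
proof (cases "A = {}")
  case True
  then show ?thesis using r by (simp add: volume_fn_def parallel_set_empty surface_fn_nonneg)
next
  case False
  let ?n = "DIM('a) - 1" and ?v = "volume_fn A" and ?H = "surface_fn A r"
  let ?d = "\<lambda>x. infdist x (closure A)"
  define K where "K = max (1 / (2 * r)) (1 / (2 * (s - r)))"
  have H: "hausdorff_measure (real ?n) (frontier {x. ?d x \<le> r}) = ennreal ?H"
    using parallel_surface_eq[OF A r(1)] by (simp add: parallel_surface_def parallel_set_eq[OF False])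
  have "0 < 1 / (2 * r)" using r by simp
  then have "0 \<le> K" unfolding K_def by linarith
  have layer: "?v R2 - ?v R1 \<le> (R2 - R1) * (R / r + 6 * K * (R2 - R1)) ^ ?n * ?H" if R: "s \<le> R1" "R1 < R2" "R2 \<le> R" for R1 R2
  proof -
    have "parallel_set A R2 - parallel_set A R1 = {x. R1 < ?d x \<and> ?d x \<le> R2}"
      by (auto simp: parallel_set_eq[OF False])
    then have "ennreal (?v R2 - ?v R1) = emeasure lborel {x. R1 < ?d x \<and> ?d x \<le> R2}"
      using emeasure_parallel_annulus[OF A, of R1 R2] R by simp
    also have "\<dots> \<le> ennreal ((R2 - R1) * (R2 / r + 6 * K * (R2 - R1)) ^ ?n * ?H)"
    proof (rule emeasure_layer_le[OF _ _ _ _ _ _ _ H surface_fn_nonneg])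
      have "1 / (2 * (R1 - r)) \<le> 1 / (2 * (s - r))" using r R by (intro divide_left_mono) auto
      then show "1 / (2 * (R1 - r)) \<le> K" by (simp add: K_def)
    qed (use False r R in \<open>auto simp: K_def\<close>)
    also have "\<dots> \<le> ennreal ((R2 - R1) * (R / r + 6 * K * (R2 - R1)) ^ ?n * ?H)"
      using r R \<open>0 \<le> K\<close> surface_fn_nonneg
      by (intro ennreal_leI mult_right_mono mult_left_mono power_mono add_right_mono divide_right_mono) auto
    finally show ?thesis
    proof (subst (asm) ennreal_le_iff)
      show "0 \<le> (R2 - R1) * (R / r + 6 * K * (R2 - R1)) ^ ?n * ?H"
        using r R \<open>0 \<le> K\<close> by (intro mult_nonneg_nonneg zero_le_power add_nonneg_nonneg surface_fn_nonneg) auto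
    qed
  qed
  have N: "?v R - ?v s \<le> (R - s) * (R / r + 6 * K * ((R - s) / Suc N)) ^ ?n * ?H" for N
  proof -
    define \<kappa> where "\<kappa> = (R - s) / Suc N"
    have \<kappa>: "0 < \<kappa>" "Suc N * \<kappa> = R - s" using r by (auto simp: \<kappa>_def)
    have "?v R - ?v s = (\<Sum>j<Suc N. ?v (s + Suc j * \<kappa>) - ?v (s + j * \<kappa>))"
      using \<kappa>(2) by (subst sum_lessThan_telescope) simp
    also have "\<dots> \<le> (\<Sum>j<Suc N. \<kappa> * (R / r + 6 * K * \<kappa>) ^ ?n * ?H)"
    proof (rule sum_mono)
      fix j assume j: "j \<in> {..<Suc N}"
      then have "real (Suc j) * \<kappa> \<le> real (Suc N) * \<kappa>" using \<kappa>(1) by (intro mult_right_mono) auto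
      then have "s + Suc j * \<kappa> \<le> R" using \<kappa>(2) by linarith
      moreover have "(s + Suc j * \<kappa>) - (s + j * \<kappa>) = \<kappa>" by (simp add: algebra_simps)
      ultimately show "?v (s + Suc j * \<kappa>) - ?v (s + j * \<kappa>) \<le> \<kappa> * (R / r + 6 * K * \<kappa>) ^ ?n * ?H"
        using layer[of "s + j * \<kappa>" "s + Suc j * \<kappa>"] \<kappa>(1) by simp
    qed
    also have "\<dots> = (Suc N * \<kappa>) * (R / r + 6 * K * \<kappa>) ^ ?n * ?H" by (simp only: sum_constant card_lessThan mult.assoc)
    finally show ?thesis using \<kappa>(2) by (simp only: \<kappa>_def)
  qed
  have "(\<lambda>N. (R - s) * (R / r + 6 * K * ((R - s) / real (Suc N))) ^ ?n * ?H) \<longlonglongrightarrow> (R - s) * (R / r + 6 * K * 0) ^ ?n * ?H"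
    by (intro tendsto_intros LIMSEQ_Suc lim_const_over_n)
  then have "?v R - ?v s \<le> (R - s) * (R / r + 6 * K * 0) ^ ?n * ?H"
    by (rule LIMSEQ_le_const) (use N in blast)
  then show ?thesis by simp
qed

text \<open>The volume is Lipschitz on \<open>{p / 2<..<2 * p}\<close>: the fixed level
  \<open>p / 4\<close> lies below all radii there and has finite surface area.\<close>

lemma isCont_volume_fn:
  fixes A :: "'a::euclidean_space set"
  assumes A: "bounded A" and p: "0 < p"
  shows "isCont (volume_fn A) p"
proof -
  let ?v = "volume_fn A"
  define L where "L = (2 * p / (p / 4)) ^ (DIM('a) - 1) * surface_fn A (p / 4)"
  have lip: "\<bar>?v x - ?v y\<bar> \<le> L * \<bar>x - y\<bar>" if "x \<in> {p / 2<..<2 * p}" "y \<in> {p / 2<..<2 * p}" for x y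
  proof -
    have *: "\<bar>?v x - ?v y\<bar> \<le> L * \<bar>x - y\<bar>" if xy: "p / 2 < y" "y < x" "x < 2 * p" for x y
    proof -
      have "?v x - ?v y \<le> (x - y) * (x / (p / 4)) ^ (DIM('a) - 1) * surface_fn A (p / 4)"
        using xy p by (intro volume_fn_diff_le[OF A]) auto
      also have "\<dots> \<le> (x - y) * (2 * p / (p / 4)) ^ (DIM('a) - 1) * surface_fn A (p / 4)"
        using xy p by (intro mult_right_mono mult_left_mono power_mono divide_right_mono surface_fn_nonneg) auto
      finally show ?thesis using volume_fn_mono[OF A, of y x] xy by (simp add: L_def mult_ac)
    qed
    show ?thesis
    proof (cases x y rule: linorder_cases)
      case less
      then show ?thesis using *[of x y] that by (simp add: abs_minus_commute)
    next
      case greater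
      then show ?thesis using *[of y x] that by simp
    qed simp
  qed
  have "((\<lambda>x. L * \<bar>x - p\<bar>) \<longlongrightarrow> L * \<bar>p - p\<bar>) (at p)" by (intro tendsto_intros)
  moreover have "\<forall>\<^sub>F x in at p. norm (?v x - ?v p) \<le> L * \<bar>x - p\<bar>"
  proof -
    have "\<forall>\<^sub>F x in at p. x \<in> {p / 2<..<2 * p}" using p by (intro eventually_at_in_open') auto
    then show ?thesis
    proof eventually_elim
      case (elim x)
      then show ?case using lip[of x p] p by simp
    qed
  qed
  ultimately have "((\<lambda>x. ?v x - ?v p) \<longlongrightarrow> 0) (at p)"
    using Lim_null_comparison[of "\<lambda>x. ?v x - ?v p" "\<lambda>x. L * \<bar>x - p\<bar>" "at p"] by simp
  then show ?thesis by (simp add: isCont_def LIM_zero_iff)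
qed

text \<open>Continuity of the volume closes the gap between \<open>r\<close> and the lower end
  \<open>s\<close> of the layers, where a direct estimate would have no finite
  \<open>K\<close>.\<close>

lemma volume_difference_quotient_le:
  fixes A :: "'a::euclidean_space set"
  assumes A: "bounded A" and r: "0 < r" "r < R"
  shows "(volume_fn A R - volume_fn A r) / (R - r) \<le> (R / r) ^ (DIM('a) - 1) * surface_fn A r"
proof -
  let ?v = "volume_fn A"
  have "(?v \<longlongrightarrow> ?v r) (at_right r)"
    using isCont_volume_fn[OF A r(1)] by (simp add: isCont_def filterlim_at_split)
  then have 1: "((\<lambda>s. ?v R - ?v s) \<longlongrightarrow> ?v R - ?v r) (at_right r)" by (intro tendsto_intros)
  have 2: "((\<lambda>s. (R - s) * (R / r) ^ (DIM('a) - 1) * surface_fn A r) \<longlongrightarrow> (R - r) * (R / r) ^ (DIM('a) - 1) * surface_fn A r) (at_right r)"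
    by (intro tendsto_intros)
  have "?v R - ?v r \<le> (R - r) * (R / r) ^ (DIM('a) - 1) * surface_fn A r"
  proof (rule tendsto_le[OF _ 2 1])
    show "\<forall>\<^sub>F s in at_right r. ?v R - ?v s \<le> (R - s) * (R / r) ^ (DIM('a) - 1) * surface_fn A r"
      using eventually_at_right_real[OF r(2)]
    proof eventually_elim
      case (elim s)
      then show ?case by (intro volume_fn_diff_le[OF A r(1)]) auto
    qed
  qed simp
  then show ?thesis using r by (simp add: divide_simps mult_ac)
qed

lemma volume_fn_tendsto_0:
  fixes A :: "'a::euclidean_space set"
  assumes A: "bounded A" and "volume_fn A 0 = 0"
  shows "(volume_fn A \<longlongrightarrow> 0) (at_right 0)"
proof -
  let ?P = "\<lambda>i. parallel_set A (inverse (real (Suc i)))"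
  have "(\<lambda>i. measure lborel (?P i)) \<longlonglongrightarrow> measure lborel (\<Inter>i. ?P i)"
  proof (rule Lim_measure_decseq)
    show "range ?P \<subseteq> sets lborel" using borel_compact[OF compact_parallel_set[OF A]] by auto
    show "decseq ?P" by (intro decseq_SucI parallel_set_mono) simp
    show "emeasure lborel (?P i) \<noteq> \<infinity>" for i by (simp add: emeasure_parallel_set[OF A])
  qed
  also have "(\<Inter>i. ?P i) = parallel_set A 0"
  proof (intro antisym subsetI)
    fix x assume x: "x \<in> (\<Inter>i. ?P i)"
    then have le: "infdist x A \<le> inverse (real (Suc i))" for i by (auto simp: parallel_set_def)
    have "infdist x A \<le> 0" by (rule LIMSEQ_le_const[OF LIMSEQ_inverse_real_of_nat]) (use le in blast)
    then show "x \<in> parallel_set A 0" using x by (auto simp: parallel_set_def)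
  next
    fix x assume "x \<in> parallel_set A 0"
    then show "x \<in> (\<Inter>i. ?P i)" using parallel_set_mono[of 0 "inverse (real (Suc i))" A for i] by auto
  qed
  finally have lim: "(\<lambda>i. volume_fn A (inverse (real (Suc i)))) \<longlonglongrightarrow> 0" using assms(2) by (simp add: volume_fn_def)
  show ?thesis
  proof (rule order_tendstoI)
    fix e :: real assume "e < 0"
    then show "\<forall>\<^sub>F r in at_right 0. e < volume_fn A r"
      by (intro always_eventually allI less_le_trans[OF _ volume_fn_nonneg])
  next
    fix e :: real assume "0 < e"
    then have "\<forall>\<^sub>F i in sequentially. volume_fn A (inverse (real (Suc i))) < e" by (rule order_tendstoD(2)[OF lim])
    then obtain i where i: "volume_fn A (inverse (real (Suc i))) < e"
      using eventually_happens'[OF sequentially_bot] by blast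
    have "\<forall>\<^sub>F r in at_right 0. r \<in> {0<..<inverse (real (Suc i))}" by (rule eventually_at_right_real) simp
    then show "\<forall>\<^sub>F r in at_right 0. volume_fn A r < e"
    proof eventually_elim
      case (elim r)
      then show ?case using i volume_fn_mono[OF A, of r "inverse (real (Suc i))"] by (simp del: of_nat_Suc)
    qed
  qed
qed

section \<open>Comparison of the contents\<close>

text \<open>Continuous induction downwards from \<open>b\<close>. The points from which on
  \<open>W\<close> stays below \<open>W b\<close> have an infimum \<open>p\<close>; the limit from
  the right puts \<open>p\<close> among them, and the local comparison at \<open>p\<close> leads
  beyond it unless \<open>p = a\<close>. Knowing only one-sided comparisons at each point, this
  stands in for the mean value theorem.\<close>

lemma le_if_left_locally_le:
  fixes W :: "real \<Rightarrow> real"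
  assumes "a \<le> b" and left: "\<And>p. a < p \<Longrightarrow> p \<le> b \<Longrightarrow> \<forall>\<^sub>F t in at_left p. W t \<le> W p"
    and right: "\<And>p. a \<le> p \<Longrightarrow> p < b \<Longrightarrow> (W \<longlongrightarrow> W p) (at_right p)"
  shows "W a \<le> W b"
proof -
  define S where "S = {x \<in> {a..b}. \<forall>y\<in>{x..b}. W y \<le> W b}"
  define p where "p = Inf S"
  have "b \<in> S" using \<open>a \<le> b\<close> by (auto simp: S_def)
  have bdd: "bdd_below S" by (auto simp: S_def intro: bdd_belowI[of _ a])
  have ab: "a \<le> p" "p \<le> b" unfolding p_def using \<open>b \<in> S\<close> bdd
    by (auto intro!: cInf_greatest cInf_lower simp: S_def)
  have above: "W y \<le> W b" if "p < y" "y \<le> b" for y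
  proof -
    obtain x where "x \<in> S" "x < y" using cInf_lessD[of S y] \<open>p < y\<close> \<open>b \<in> S\<close> by (auto simp: p_def)
    then show ?thesis using that by (auto simp: S_def)
  qed
  have Wp: "W p \<le> W b"
  proof (cases "p = b")
    case False
    then have "p < b" using ab by simp
    have "\<forall>\<^sub>F y in at_right p. W y \<le> W b"
      using eventually_at_right_real[OF \<open>p < b\<close>] by eventually_elim (auto intro: above)
    then show ?thesis by (rule tendsto_upperbound[OF right[OF ab(1) \<open>p < b\<close>]]) simp
  qed simp
  have "p = a"
  proof (rule ccontr)
    assume "p \<noteq> a"
    then have "a < p" using ab by simp
    obtain q where q: "q < p" "\<And>y. q < y \<Longrightarrow> y < p \<Longrightarrow> W y \<le> W p"
      using left[OF \<open>a < p\<close> ab(2)] unfolding eventually_at_left_field by blast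
    define x where "x = max ((q + p) / 2) a"
    have x: "q < x" "x < p" "a \<le> x" using q(1) \<open>a < p\<close> by (auto simp: x_def less_max_iff_disj)
    have "W y \<le> W b" if "x \<le> y" "y \<le> b" for y
      using q(2)[of y] above[of y] Wp x that by (cases y p rule: linorder_cases) auto
    then have "x \<in> S" using x ab by (auto simp: S_def)
    then show False using cInf_lower[OF _ bdd] x by (fastforce simp: p_def)
  qed
  then show ?thesis using Wp by simp
qed

lemma le_if_right_locally_le:
  fixes W :: "real \<Rightarrow> real"
  assumes "a \<le> b" and right: "\<And>p. a \<le> p \<Longrightarrow> p < b \<Longrightarrow> \<forall>\<^sub>F t in at_right p. W t \<le> W p"
    and left: "\<And>p. a < p \<Longrightarrow> p \<le> b \<Longrightarrow> (W \<longlongrightarrow> W p) (at_left p)"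
  shows "W b \<le> W a"
proof -
  have "(\<lambda>x. W (- x)) (- b) \<le> (\<lambda>x. W (- x)) (- a)"
  proof (rule le_if_left_locally_le[where W = "\<lambda>x. W (- x)"])
    fix p assume "- b < p" "p \<le> - a"
    then show "\<forall>\<^sub>F t in at_left p. W (- t) \<le> W (- p)"
      using right[of "- p"] by (simp add: at_left_minus eventually_filtermap)
  next
    fix p assume "- b \<le> p" "p < - a"
    then show "((\<lambda>x. W (- x)) \<longlongrightarrow> W (- p)) (at_right p)"
      using left[of "- p"] by (simp add: at_right_minus[of p] filterlim_filtermap)
  qed (use assms in simp)
  then show ?thesis by simp
qed

text \<open>The derivative may be discontinuous, so its sign is settled by Rolle's theorem. If it
  were negative at \<open>r\<close>, then \<open>h\<close> would exceed \<open>h r\<close> somewhere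
  to the left; as \<open>h\<close> tends to 0, the value \<open>h r\<close> would recur at some
  \<open>x < r\<close>, forcing a zero of the derivative in between.\<close>

lemma deriv_pos_near_0:
  fixes h :: "real \<Rightarrow> real"
  assumes pos: "\<And>r. 0 < r \<Longrightarrow> 0 < h r" and diff: "\<And>r. 0 < r \<Longrightarrow> h differentiable (at r)"
    and lim: "(h \<longlongrightarrow> 0) (at_right 0)" and nz: "\<And>r. 0 < r \<Longrightarrow> r < \<epsilon> \<Longrightarrow> deriv h r \<noteq> 0"
    and r: "0 < r" "r < \<epsilon>"
  shows "0 < deriv h r"
proof (rule ccontr)
  assume "\<not> 0 < deriv h r"
  then have neg: "deriv h r < 0" using nz[OF r] by simp
  have D: "(h has_real_derivative deriv h x) (at x)" if "0 < x" for x
    using diff[OF that] by (simp add: DERIV_deriv_iff_real_differentiable)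
  have cont: "continuous_on {a..b} h" if "0 < a" for a b
    using that by (intro continuous_at_imp_continuous_on ballI DERIV_isCont[OF D]) auto
  obtain d where d: "d > 0" "\<And>k. 0 < k \<Longrightarrow> k < d \<Longrightarrow> h r < h (r - k)"
    using DERIV_neg_dec_left[OF D[OF r(1)] neg] by blast
  define s where "s = r - min (d / 2) (r / 2)"
  have s: "0 < s" "s < r" "h r < h s" using d(2)[of "min (d / 2) (r / 2)"] d(1) r by (auto simp: s_def)
  have "\<forall>\<^sub>F q in at_right 0. h q < h r" using order_tendstoD(2)[OF lim pos[OF r(1)]] .
  moreover have "\<forall>\<^sub>F q in at_right 0. q \<in> {0<..<s}" using s(1) by (rule eventually_at_right_real)
  ultimately have "\<forall>\<^sub>F q in at_right 0. h q < h r \<and> q \<in> {0<..<s}" by (rule eventually_conj)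
  then obtain q where q: "h q < h r" "0 < q" "q < s"
    using eventually_happens'[of "at_right (0::real)"] trivial_limit_at_right_real by fastforce
  obtain x where x: "q \<le> x" "x \<le> s" "h x = h r"
    using IVT'[of h q "h r" s] q s cont[OF q(2)] by auto
  have "\<exists>z. x < z \<and> z < r \<and> deriv h z = 0"
  proof -
    have "\<And>z. x < z \<Longrightarrow> z < r \<Longrightarrow> (h has_derivative (*) (deriv h z)) (at z)"
      using D x q by (auto simp: has_field_derivative_def[symmetric])
    then obtain z where z: "x < z" "z < r" "(*) (deriv h z) = (\<lambda>v. 0)"
      using Rolle_deriv[of x r h "\<lambda>z. (*) (deriv h z)"] x s q cont[of x r] by auto
    have "deriv h z = 0" using fun_cong[OF z(3), of 1] by simp
    then show ?thesis using z by blast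
  qed
  then show False using nz x q r by force
qed

section \<open>From inequalities for the surface area to inequalities for the volume\<close>

lemma DERIV_difference_quotient:
  assumes "(h has_real_derivative D) (at p)"
  shows "((\<lambda>t. (h t - h p) / (t - p)) \<longlongrightarrow> D) (at p within S)"
  using assms tendsto_within_subset[of _ _ p UNIV S] by (auto simp: has_field_derivative_iff)

text \<open>The strict inequality survives the passage from the derivative of \<open>h\<close> to
  its difference quotients near \<open>p\<close>, where \<open>(t / p) ^ ?n\<close> is close to 1;
  this gives the local comparison to the left of \<open>p\<close>. At the lower end point the volume
  is bounded below by 0. The constant \<open>c\<close> may have either sign.\<close>

lemma volume_ge_if_surface_ge:
  fixes A :: "'a::euclidean_space set" and h :: "real \<Rightarrow> real"
  assumes A: "bounded A" and D: "\<And>r. 0 < r \<Longrightarrow> (h has_real_derivative h' r) (at r)" and h0: "(h \<longlongrightarrow> 0) (at_right 0)"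
    and S: "\<And>r. 0 < r \<Longrightarrow> r < \<epsilon> \<Longrightarrow> c * h' r < surface_fn A r" and r: "0 < r" "r < \<epsilon>"
  shows "c * h r \<le> volume_fn A r"
proof -
  let ?v = "volume_fn A" and ?n = "DIM('a) - 1"
  have "?v s - c * h s \<le> ?v r - c * h r" if s: "0 < s" "s < r" for s
  proof (rule le_if_left_locally_le[where W = "\<lambda>t. ?v t - c * h t"])
    fix p assume p: "s < p" "p \<le> r"
    have p0: "0 < p" using p s by simp
    have "((\<lambda>t. (t / p) ^ ?n * surface_fn A p - c * ((h t - h p) / (t - p))) \<longlongrightarrow> (p / p) ^ ?n * surface_fn A p - c * h' p) (at_left p)"
      by (intro tendsto_intros DERIV_difference_quotient D p0) (use p0 in auto)
    moreover have "0 < (p / p) ^ ?n * surface_fn A p - c * h' p" using S[of p] p s r by simp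
    ultimately have "\<forall>\<^sub>F t in at_left p. 0 < (t / p) ^ ?n * surface_fn A p - c * ((h t - h p) / (t - p))"
      by (rule order_tendstoD(1))
    moreover have "\<forall>\<^sub>F t in at_left p. t \<in> {0<..<p}" using p0 by (rule eventually_at_left_real)
    ultimately show "\<forall>\<^sub>F t in at_left p. ?v t - c * h t \<le> ?v p - c * h p"
    proof eventually_elim
      case (elim t)
      have "c * ((h t - h p) / (t - p)) \<le> (?v p - ?v t) / (p - t)"
        using surface_fn_le_difference_quotient[OF A, of t p] elim by simp
      also have "(h t - h p) / (t - p) = (h p - h t) / (p - t)" by (metis minus_diff_eq minus_divide_divide)
      finally have "c * (h p - h t) \<le> ?v p - ?v t" using elim by (simp add: divide_simps)
      then show ?case by (simp add: algebra_simps)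
    qed
  next
    fix p assume p: "s \<le> p" "p < r"
    then have "isCont (\<lambda>t. ?v t - c * h t) p"
      using s isCont_volume_fn[OF A, of p] DERIV_isCont[OF D, of p] by (intro continuous_intros) auto
    then show "((\<lambda>t. ?v t - c * h t) \<longlongrightarrow> ?v p - c * h p) (at_right p)"
      by (simp add: isCont_def filterlim_at_split)
  qed (use s in simp)
  then have le: "- (c * h s) \<le> ?v r - c * h r" if "0 < s" "s < r" for s
    using that volume_fn_nonneg[of A s] by fastforce
  have "((\<lambda>s. - (c * h s)) \<longlongrightarrow> - (c * 0)) (at_right 0)" by (intro tendsto_intros h0)
  moreover have "\<forall>\<^sub>F s in at_right 0. - (c * h s) \<le> ?v r - c * h r"
    using eventually_at_right_real[OF r(1)] by eventually_elim (use le in auto)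
  ultimately have "- (c * 0) \<le> ?v r - c * h r" by (rule tendsto_upperbound) simp
  then show ?thesis by simp
qed

text \<open>The mirror image, with comparisons to the right of \<open>p\<close>. At the lower end
  point an upper bound is needed, supplied by the volume tending to 0.\<close>

lemma volume_le_if_surface_le:
  fixes A :: "'a::euclidean_space set" and h :: "real \<Rightarrow> real"
  assumes A: "bounded A" "volume_fn A 0 = 0"
    and D: "\<And>r. 0 < r \<Longrightarrow> (h has_real_derivative h' r) (at r)" and h0: "(h \<longlongrightarrow> 0) (at_right 0)"
    and S: "\<And>r. 0 < r \<Longrightarrow> r < \<epsilon> \<Longrightarrow> surface_fn A r < c * h' r" and r: "0 < r" "r < \<epsilon>"
  shows "volume_fn A r \<le> c * h r"
proof -
  let ?v = "volume_fn A" and ?n = "DIM('a) - 1"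
  have le: "?v r - c * h r \<le> ?v s - c * h s" if s: "0 < s" "s < r" for s
  proof (rule le_if_right_locally_le[where W = "\<lambda>t. ?v t - c * h t"])
    fix p assume p: "s \<le> p" "p < r"
    have p0: "0 < p" using p s by simp
    have "((\<lambda>t. c * ((h t - h p) / (t - p)) - (t / p) ^ ?n * surface_fn A p) \<longlongrightarrow> c * h' p - (p / p) ^ ?n * surface_fn A p) (at_right p)"
      by (intro tendsto_intros DERIV_difference_quotient D p0) (use p0 in auto)
    moreover have "0 < c * h' p - (p / p) ^ ?n * surface_fn A p" using S[of p] p s r by simp
    ultimately have "\<forall>\<^sub>F t in at_right p. 0 < c * ((h t - h p) / (t - p)) - (t / p) ^ ?n * surface_fn A p"
      by (rule order_tendstoD(1))
    moreover have "\<forall>\<^sub>F t in at_right p. t \<in> {p<..<p + 1}" by (rule eventually_at_right_real) simp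
    ultimately show "\<forall>\<^sub>F t in at_right p. ?v t - c * h t \<le> ?v p - c * h p"
    proof eventually_elim
      case (elim t)
      have "(?v t - ?v p) / (t - p) \<le> c * ((h t - h p) / (t - p))"
        using volume_difference_quotient_le[OF A(1), of p t] elim p0 by simp
      then have "?v t - ?v p \<le> c * (h t - h p)" using elim by (simp add: divide_simps)
      then show ?case by (simp add: algebra_simps)
    qed
  next
    fix p assume p: "s < p" "p \<le> r"
    then have "isCont (\<lambda>t. ?v t - c * h t) p"
      using s isCont_volume_fn[OF A(1), of p] DERIV_isCont[OF D, of p] by (intro continuous_intros) auto
    then show "((\<lambda>t. ?v t - c * h t) \<longlongrightarrow> ?v p - c * h p) (at_left p)"
      by (simp add: isCont_def filterlim_at_split)
  qed (use s in simp)
  have "((\<lambda>s. ?v s - c * h s) \<longlongrightarrow> 0 - c * 0) (at_right 0)" by (intro tendsto_intros h0 volume_fn_tendsto_0[OF A])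
  moreover have "\<forall>\<^sub>F s in at_right 0. ?v r - c * h r \<le> ?v s - c * h s"
    using eventually_at_right_real[OF r(1)] by eventually_elim (use le in auto)
  ultimately have "?v r - c * h r \<le> 0 - c * 0" by (rule tendsto_lowerbound) simp
  then show ?thesis by simp
qed

theorem theorem3p2:
  fixes A :: "'a::euclidean_space set" and h :: "real \<Rightarrow> real"
  assumes "bounded A"
    and "parallel_volume A 0 = 0"
    and "\<forall>r>0. h r > 0"
    and "\<forall>r>0. h differentiable (at r)"
    and "(h \<longlongrightarrow> 0) (at_right 0)"
    and "\<exists>\<epsilon>>0. \<forall>r. 0 < r \<and> r < \<epsilon> \<longrightarrow> deriv h r \<noteq> 0"
  shows "lower_S_content (deriv h) A \<le> lower_minkowski_content h A \<and>
         lower_minkowski_content h A \<le> upper_minkowski_content h A \<and>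
         upper_minkowski_content h A \<le> upper_S_content (deriv h) A"
proof -
  let ?v = "volume_fn A" and ?s = "surface_fn A" and ?F = "at_right (0::real)"
  obtain \<epsilon> where \<epsilon>: "\<epsilon> > 0" "\<And>r. 0 < r \<Longrightarrow> r < \<epsilon> \<Longrightarrow> deriv h r \<noteq> 0" using assms(6) by blast
  have pos: "0 < deriv h r" if "0 < r" "r < \<epsilon>" for r
    using assms(3-5) \<epsilon>(2) that by (intro deriv_pos_near_0[of h \<epsilon> r]) auto
  have D: "(h has_real_derivative deriv h r) (at r)" if "0 < r" for r
    using assms(4) that by (simp add: DERIV_deriv_iff_real_differentiable)
  have v0: "?v 0 = 0" using assms(2) by (simp add: parallel_volume_eq[OF assms(1)] volume_fn_nonneg)
  have near: "\<forall>\<^sub>F r in ?F. r \<in> {0<..<\<epsilon>}" using \<epsilon>(1) by (rule eventually_at_right_real)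
  \<comment> \<open>Near 0 all numerators are finite and all denominators nonzero, so the extended
    quotients are real ones.\<close>
  have qv: "\<forall>\<^sub>F r in ?F. enn2ereal (parallel_volume A r) / ereal (h r) = ereal (?v r / h r)"
    using near
  proof eventually_elim
    case (elim r)
    then have "h r \<noteq> 0" using assms(3) by force
    then show ?case by (simp add: parallel_volume_eq[OF assms(1)] volume_fn_nonneg enn2ereal_ennreal)
  qed
  have qs: "\<forall>\<^sub>F r in ?F. enn2ereal (parallel_surface A r) / ereal (deriv h r) = ereal (?s r / deriv h r)"
    using near
  proof eventually_elim
    case (elim r)
    then have "deriv h r \<noteq> 0" "parallel_surface A r = ennreal (?s r)"
      using \<epsilon>(2) parallel_surface_eq[OF assms(1)] by auto
    then show ?case by (simp add: surface_fn_nonneg enn2ereal_ennreal)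
  qed
  have nz: "?F \<noteq> bot" by simp
  have "lower_S_content (deriv h) A \<le> lower_minkowski_content h A"
    unfolding lower_S_content_def lower_minkowski_content_def Liminf_eq[OF qv] Liminf_eq[OF qs]
  \<comment> \<open>A \<open>y\<close> strictly below the lower limit is either minus infinity, a
    trivial case, or a real \<open>c\<close>, for which the strict inequality holds on a whole
    interval from 0 to some \<open>b\<close>, as the comparison of functions requires.\<close>
  proof (rule dense_le)
    fix y assume y: "y < Liminf ?F (\<lambda>r. ereal (?s r / deriv h r))"
    show "y \<le> Liminf ?F (\<lambda>r. ereal (?v r / h r))"
    proof (cases y)
      case (real c)
      have "\<forall>\<^sub>F r in ?F. c < ?s r / deriv h r" using less_LiminfD[OF y] real by simp
      with near have "\<forall>\<^sub>F r in ?F. c * deriv h r < ?s r"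
        by eventually_elim (use pos in \<open>auto simp: pos_less_divide_eq\<close>)
      then obtain b where b: "b > 0" "\<And>r. 0 < r \<Longrightarrow> r < b \<Longrightarrow> c * deriv h r < ?s r"
        by (auto simp: eventually_at_right_field)
      have "\<forall>\<^sub>F r in ?F. r \<in> {0<..<b}" using b(1) by (rule eventually_at_right_real)
      then have "\<forall>\<^sub>F r in ?F. y \<le> ereal (?v r / h r)"
      proof eventually_elim
        case (elim r)
        then have "c * h r \<le> ?v r" by (intro volume_ge_if_surface_ge[OF assms(1) D assms(5) b(2)]) auto
        then show ?case using elim assms(3) by (simp add: real pos_le_divide_eq)
      qed
      then show ?thesis by (rule Liminf_bounded)
    qed (use y in auto)
  qed
  moreover have "upper_minkowski_content h A \<le> upper_S_content (deriv h) A"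
    unfolding upper_S_content_def upper_minkowski_content_def Limsup_eq[OF qv] Limsup_eq[OF qs]
  proof (rule dense_ge)
    fix y assume y: "Limsup ?F (\<lambda>r. ereal (?s r / deriv h r)) < y"
    show "Limsup ?F (\<lambda>r. ereal (?v r / h r)) \<le> y"
    proof (cases y)
      case (real c)
      have "\<forall>\<^sub>F r in ?F. ?s r / deriv h r < c" using Limsup_lessD[OF y] real by simp
      with near have "\<forall>\<^sub>F r in ?F. ?s r < c * deriv h r"
        by eventually_elim (use pos in \<open>auto simp: pos_divide_less_eq\<close>)
      then obtain b where b: "b > 0" "\<And>r. 0 < r \<Longrightarrow> r < b \<Longrightarrow> ?s r < c * deriv h r"
        by (auto simp: eventually_at_right_field)
      have "\<forall>\<^sub>F r in ?F. r \<in> {0<..<b}" using b(1) by (rule eventually_at_right_real)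
      then have "\<forall>\<^sub>F r in ?F. ereal (?v r / h r) \<le> y"
      proof eventually_elim
        case (elim r)
        then have "?v r \<le> c * h r" by (intro volume_le_if_surface_le[OF assms(1) v0 D assms(5) b(2)]) auto
        then show ?case using elim assms(3) by (simp add: real pos_divide_le_eq)
      qed
      then show ?thesis by (rule Limsup_bounded)
    qed (use y in auto)
  qed
  moreover have "lower_minkowski_content h A \<le> upper_minkowski_content h A"
    unfolding lower_minkowski_content_def upper_minkowski_content_def by (rule Liminf_le_Limsup[OF nz])
  ultimately show ?thesis by blast
qed

end
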